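(* Let $n\geqslant 2$, $p>1$, let $D\subset\mathbb{R}^n$ be a domain, and let $f:D\to\mathbb{R}^n$ be a mapping which is differentiable almost everywhere in $D$, has the Luzin $N$- and $N^{-1}$-properties with respect to Lebesgue measure in $\mathbb{R}^n$, and satisfies $f\in ACP_p(D)$. Let $y_0\in\overline{f(D)}\setminus\{\infty\}$. Put $$K_{CT,p,y_0}(y,f)=\sum_{x\in f^{-1}(y)}\frac{\left(\sup_{|h|=1}\left|\left(f'(x)h,\frac{f(x)-y_0}{|f(x)-y_0|}\right)\right|\right)^p}{|J(x,f)|}.$$ Then $f$ satisfies the inverse Poletsky inequality at $y_0$ with respect to the $p$-modulus with $Q_*(y)=K_{CT,p,y_0}(y,f)$; that is, for all $0<r_1<r_2<r_0:=\sup_{y\in f(D)}|y-y_0|$ and every Lebesgue measurable function $\eta:(r_1,r_2)\to[0,\infty]$ with $\int_{r_1}^{r_2}\eta(r)\,dr\geqslant 1$, $$M_p(\Gamma_f(y_0,r_1,r_2))\leqslant\int_{A(y_0,r_1,r_2)\cap f(D)}K_{CT,p,y_0}(y,f)\cdot\eta^p(|y-y_0|)\,dm(y).$$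
   Context: Notation: $(\cdot,\cdot)$ is the Euclidean scalar product, $m$ is Lebesgue measure in $\mathbb{R}^n$, $f'(x)$ is the derivative of $f$ at a point of differentiability $x$, and $J(x,f)=\det f'(x)$. The closure $\overline{f(D)}$ is taken in $\overline{\mathbb{R}^n}=\mathbb{R}^n\cup\{\infty\}$. Luzin properties: $f$ has the $N$-property if $m(E)=0$, $E\subset D$, implies $m(f(E))=0$; $f$ has the $N^{-1}$-property if $m(E)=0$, $E\subset\mathbb{R}^n$, implies $m(f^{-1}(E))=0$. Under these hypotheses, for almost every $y$ the mapping $f$ is differentiable with $J(x,f)\neq0$ at every $x\in f^{-1}(y)$, so $K_{CT,p,y_0}(y,f)\in[0,\infty]$ is defined for almost every $y$ (the values on the exceptional null set are irrelevant). It is called the cotangent dilatation of $f$ of order $p$ at $y_0$. Modulus: for a family $\Gamma$ of curves in $\mathbb{R}^n$, a Borel function $\rho:\mathbb{R}^n\to[0,\infty]$ is admissible, $\rho\in\mathrm{adm}\,\Gamma$, if $\int_\gamma\rho(x)\,|dx|\geqslant1$ for every locally rectifiable $\gamma\in\Gamma$; $M_p(\Gamma)=\inf_{\rho\in\mathrm{adm}\,\Gamma}\int_{\mathbb{R}^n}\rho^p(x)\,dm(x)$. A property holds for $p$-almost all curves in $D$ if it can fail only on a family $\Gamma_0$ of curves in $D$ with $M_p(\Gamma_0)=0$. Class $ACP_p$: for a rectifiable closed curve (a curve defined on a closed interval) $\alpha:[a,b]\to\mathbb{R}^n$ of length $l(\alpha)$, its normal representation is the unique curve $\alpha^0:[0,l(\alpha)]\to\mathbb{R}^n$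 with $\alpha(t)=\alpha^0(S(\alpha,[a,t]))$, where $S(\alpha,[a,t])$ is the length of $\alpha|_{[a,t]}$. A mapping $f$ is absolutely continuous on $\alpha$ if $f\circ\alpha^0$ is absolutely continuous on $[0,l(\alpha)]$. One writes $f\in ACP_p(D)$ if for $p$-almost all curves $\gamma$ in $D$ the restriction of $f$ to $\gamma$ is locally absolutely continuous, i.e. $f$ is absolutely continuous on every closed rectifiable subcurve of $\gamma$. Curve families: $A(y_0,r_1,r_2)=\{y\in\mathbb{R}^n: r_1<|y-y_0|<r_2\}$ and $S(y_0,r)=\{y\in\mathbb{R}^n:|y-y_0|=r\}$. For sets $E,F\subset\overline{\mathbb{R}^n}$ and a domain $G\subset\mathbb{R}^n$, $\Gamma(E,F,G)$ is the family of all curves $\gamma:[a,b]\to\overline{\mathbb{R}^n}$ with $\gamma(a)\in E$, $\gamma(b)\in F$ and $\gamma(t)\in G$ for $t\in(a,b)$. $\Gamma_f(y_0,r_1,r_2)$ is the family of all curves $\gamma$ in $D$ such that $f\circ\gamma\in\Gamma(S(y_0,r_1),S(y_0,r_2),A(y_0,r_1,r_2))$. *)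

theory Defs
  imports "HOL-Analysis.Analysis"
begin

text \<open>Real powers with values in \<open>[0,\<infinity>]\<close>, for positive exponents.\<close>

definition ennpowr :: "ennreal \<Rightarrow> real \<Rightarrow> ennreal" where
  "ennpowr x p = (if x = \<infinity> then \<infinity> else ennreal (enn2real x powr p))"

section \<open>Curves, length, normal representation\<close>

text \<open>A curve is a pair of a parameter interval (open, closed or half-open, possibly unbounded) and
  a map that is continuous on it; the values of the map outside the interval carry no meaning.\<close>

type_synonym 'a curve = "real set \<times> (real \<Rightarrow> 'a)"

definition curves_in :: "'a::topological_space set \<Rightarrow> 'a curve set" where
  "curves_in D = {(I, g). is_interval I \<and> I \<noteq> {} \<and> continuous_on I g \<and> g ` I \<subseteq> D}"

definition curve_length :: "(real \<Rightarrow> 'a::metric_space) \<Rightarrow> real \<Rightarrow> real \<Rightarrow> ennreal" where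
  "curve_length g a b =
     (SUP ts \<in> {ts. sorted ts \<and> set ts \<subseteq> {a..b}}.
        \<Sum>i < length ts - 1. ennreal (dist (g (ts ! i)) (g (ts ! Suc i))))"

definition rectifiable :: "(real \<Rightarrow> 'a::metric_space) \<Rightarrow> real \<Rightarrow> real \<Rightarrow> bool" where
  "rectifiable g a b \<longleftrightarrow> curve_length g a b < \<infinity>"

fun locally_rectifiable :: "'a::metric_space curve \<Rightarrow> bool" where
  "locally_rectifiable (I, g) \<longleftrightarrow> (\<forall>a b. a \<le> b \<and> {a..b} \<subseteq> I \<longrightarrow> rectifiable g a b)"

text \<open>Requiring extensionality makes the description unique as a total function.\<close>

definition normal_rep :: "(real \<Rightarrow> 'a::metric_space) \<Rightarrow> real \<Rightarrow> real \<Rightarrow> real \<Rightarrow> 'a" where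
  "normal_rep g a b =
     (THE h. h \<in> extensional {0..enn2real (curve_length g a b)} \<and>
             (\<forall>t\<in>{a..b}. g t = h (enn2real (curve_length g a t))))"

text \<open>The integral over a locally rectifiable curve is the supremum of the integrals over its closed
  subcurves; on a closed rectifiable curve this is the integral over the curve itself.\<close>

fun line_integral :: "('a::metric_space \<Rightarrow> ennreal) \<Rightarrow> 'a curve \<Rightarrow> ennreal" where
  "line_integral \<rho> (I, g) =
     (SUP (a, b) \<in> {(a, b). a \<le> b \<and> {a..b} \<subseteq> I}.
        \<integral>\<^sup>+s\<in>{0..enn2real (curve_length g a b)}. \<rho> (normal_rep g a b s) \<partial>lborel)"

section \<open>Modulus of curve families and the class \<open>ACP\<close>\<close>

definition admissible :: "'a::euclidean_space curve set \<Rightarrow> ('a \<Rightarrow> ennreal) set" where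
  "admissible \<Gamma> =
     {\<rho> \<in> borel_measurable borel. \<forall>c\<in>\<Gamma>. locally_rectifiable c \<longrightarrow> line_integral \<rho> c \<ge> 1}"

definition modulus :: "real \<Rightarrow> 'a::euclidean_space curve set \<Rightarrow> ennreal" where
  "modulus p \<Gamma> = (INF \<rho> \<in> admissible \<Gamma>. \<integral>\<^sup>+x. ennpowr (\<rho> x) p \<partial>lborel)"

definition almost_all_curves ::
    "real \<Rightarrow> 'a::euclidean_space set \<Rightarrow> ('a curve \<Rightarrow> bool) \<Rightarrow> bool" where
  "almost_all_curves p D P \<longleftrightarrow>
     (\<exists>\<Gamma>0. \<Gamma>0 \<subseteq> curves_in D \<and> modulus p \<Gamma>0 = 0 \<and> (\<forall>c \<in> curves_in D - \<Gamma>0. P c))"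

definition abs_cont :: "(real \<Rightarrow> 'a::metric_space) \<Rightarrow> real \<Rightarrow> real \<Rightarrow> bool" where
  "abs_cont F a b \<longleftrightarrow>
     (\<forall>\<epsilon>>0. \<exists>\<delta>>0. \<forall>(n::nat) u v.
        (\<forall>i<n. a \<le> u i \<and> u i \<le> v i \<and> v i \<le> b) \<and>
        disjoint_family_on (\<lambda>i. {u i<..<v i}) {..<n} \<and> (\<Sum>i<n. v i - u i) < \<delta> \<longrightarrow>
        (\<Sum>i<n. dist (F (u i)) (F (v i))) < \<epsilon>)"

definition abs_cont_on_curve ::
    "('a::metric_space \<Rightarrow> 'b::metric_space) \<Rightarrow> (real \<Rightarrow> 'a) \<Rightarrow> real \<Rightarrow> real \<Rightarrow> bool" where
  "abs_cont_on_curve f g a b \<longleftrightarrow>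
     abs_cont (f \<circ> normal_rep g a b) 0 (enn2real (curve_length g a b))"

fun locally_abs_cont_on :: "('a::metric_space \<Rightarrow> 'b::metric_space) \<Rightarrow> 'a curve \<Rightarrow> bool" where
  "locally_abs_cont_on f (I, g) \<longleftrightarrow>
     (\<forall>a b. a \<le> b \<and> {a..b} \<subseteq> I \<and> rectifiable g a b \<longrightarrow> abs_cont_on_curve f g a b)"

definition ACP ::
    "real \<Rightarrow> 'a::euclidean_space set \<Rightarrow> ('a \<Rightarrow> 'b::metric_space) \<Rightarrow> bool" where
  "ACP p D f \<longleftrightarrow> almost_all_curves p D (locally_abs_cont_on f)"

section \<open>Luzin properties\<close>

definition Luzin_N :: "'a::euclidean_space set \<Rightarrow> ('a \<Rightarrow> 'a) \<Rightarrow> bool" where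
  "Luzin_N D f \<longleftrightarrow> (\<forall>E. E \<subseteq> D \<and> E \<in> null_sets lebesgue \<longrightarrow> f ` E \<in> null_sets lebesgue)"

definition Luzin_N_inv :: "'a::euclidean_space set \<Rightarrow> ('a \<Rightarrow> 'a) \<Rightarrow> bool" where
  "Luzin_N_inv D f \<longleftrightarrow>
     (\<forall>E. E \<in> null_sets lebesgue \<longrightarrow> {x \<in> D. f x \<in> E} \<in> null_sets lebesgue)"

section \<open>Cotangent dilatation and the inverse Poletsky inequality\<close>

definition jacobian :: "(real^'n \<Rightarrow> real^'n) \<Rightarrow> real^'n \<Rightarrow> real" where
  "jacobian f x = det (matrix (frechet_derivative f (at x)))"

definition cotangent_dilatation ::
    "real \<Rightarrow> (real^'n) set \<Rightarrow> (real^'n \<Rightarrow> real^'n) \<Rightarrow> real^'n \<Rightarrow> real^'n \<Rightarrow> ennreal" where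
  "cotangent_dilatation p D f y0 y =
     (\<Sum>\<^sub>\<infinity>x\<in>{x \<in> D. f x = y}.
        ennreal ((SUP h\<in>sphere 0 1.
          \<bar>frechet_derivative f (at x) h \<bullet> ((f x - y0) /\<^sub>R norm (f x - y0))\<bar>) powr p)
        / ennreal \<bar>jacobian f x\<bar>)"

definition annulus :: "'a::metric_space \<Rightarrow> real \<Rightarrow> real \<Rightarrow> 'a set" where
  "annulus y0 r1 r2 = {y. r1 < dist y y0 \<and> dist y y0 < r2}"

text \<open>The family \<open>\<Gamma>(E, F, G)\<close> for finite \<open>E\<close> and \<open>F\<close>, i.e. \<open>\<infinity> \<notin> E \<union> F\<close>: since \<open>\<infinity> \<notin> G\<close> as
  well, its curves never meet the point at infinity.\<close>

definition joining_curves :: "'a::topological_space set \<Rightarrow> 'a set \<Rightarrow> 'a set \<Rightarrow> 'a curve set" where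
  "joining_curves E F G =
     {(I, g). \<exists>a b. a \<le> b \<and> I = {a..b} \<and> continuous_on I g \<and>
        g a \<in> E \<and> g b \<in> F \<and> (\<forall>t\<in>{a<..<b}. g t \<in> G)}"

definition preimage_family ::
    "'a::metric_space set \<Rightarrow> ('a \<Rightarrow> 'a) \<Rightarrow> 'a \<Rightarrow> real \<Rightarrow> real \<Rightarrow> 'a curve set" where
  "preimage_family D f y0 r1 r2 =
     {(I, g) \<in> curves_in D.
        (I, f \<circ> g) \<in> joining_curves (sphere y0 r1) (sphere y0 r2) (annulus y0 r1 r2)}"

definition inverse_Poletsky ::
    "real \<Rightarrow> 'a::euclidean_space set \<Rightarrow> ('a \<Rightarrow> 'a) \<Rightarrow> 'a \<Rightarrow> ('a \<Rightarrow> ennreal) \<Rightarrow> bool" where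
  "inverse_Poletsky p D f y0 Q \<longleftrightarrow>
     (\<forall>r1 r2 \<eta>.
        0 < r1 \<and> r1 < r2 \<and> ennreal r2 < (SUP y\<in>f ` D. ennreal (dist y y0)) \<and>
        \<eta> \<in> borel_measurable (lebesgue_on {r1<..<r2}) \<and>
        (\<integral>\<^sup>+r\<in>{r1<..<r2}. \<eta> r \<partial>lebesgue) \<ge> 1 \<longrightarrow>
        modulus p (preimage_family D f y0 r1 r2)
          \<le> (\<integral>\<^sup>+y\<in>annulus y0 r1 r2 \<inter> f ` D. Q y * ennpowr (\<eta> (dist y y0)) p \<partial>lebesgue))"

end

(* Let L(x) be the norm of the derivative of |f - y0| at x. Then rho(x) = eta(|f(x) - y0|) L(x) is
   admissible up to a negligible family: along the normal representation g of a curve on which f is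
   absolutely continuous, r(s) = |f(g(s)) - y0| is absolutely continuous, maps null sets to null sets,
   covers (r1, r2), and grows at s at rate at most L(g(s)) because g is 1-Lipschitz. Hence
   int eta(r(s)) L(g(s)) ds >= int_{r1}^{r2} eta >= 1, without differentiating g.
   The integral of rho^p is then turned into an integral over the image by the change of variables
   formula on countably many pieces on which f is injective; Sard's theorem and the N^{-1}-property
   make the Jacobian nonzero almost everywhere. *)

theory Submission
  imports Defs
begin

section \<open>Arc length and the normal representation\<close>

text \<open>Measurability shapes the proof in three places. A density for the modulus has to be
  Borel on the whole space, whereas \<open>f\<close> and its derivative are only shown to be
  Lebesgue measurable off a null set; hence Borel representatives are used outside one Borel null
  set. The image of a measurable set of parameters under \<bar>f - y0\<bar> along a curve is not
  known to be measurable; hence the one-dimensional estimates are made for outer measure, turned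
  into an inequality between two Borel measures, and only then integrated against eta. The sum over
  a fibre is not shown to be measurable in y; hence the change of variables is an inequality,
  reached through countably many measurable inverse branches. A further obstacle is that the normal
  representation is a definite description: it denotes something useful only once the arc length of
  a continuous rectifiable curve is known to take all intermediate values. The Jacobian vanishes
  only on a null set because the zero set Z lies in the preimage of f(Z), which is null by Sard's
  theorem.\<close>

lemma curve_length_upper:
  assumes "sorted ts" "set ts \<subseteq> {a..b}"
  shows "(\<Sum>i < length ts - 1. ennreal (dist (g (ts ! i)) (g (ts ! Suc i)))) \<le> curve_length g a b"
  unfolding curve_length_def by (rule SUP_upper) (use assms in auto)

lemma curve_length_refl [simp]: "curve_length g a a = 0"
proof -
  have "(\<Sum>i < length ts - 1. ennreal (dist (g (ts ! i)) (g (ts ! Suc i)))) = 0"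
    if "set ts \<subseteq> {a..a}" for ts
  proof -
    have "ts ! i = a" if "i < length ts" for i
      using nth_mem[OF that] \<open>set ts \<subseteq> {a..a}\<close> by auto
    then show ?thesis by (intro sum.neutral ballI) auto
  qed
  then show ?thesis
    unfolding curve_length_def by (auto simp: bot_ennreal intro!: antisym SUP_least)
qed

text \<open>A partition of [a,s] followed by \<open>t\<close> is a partition of [a,t]. This makes
  the increments of arc length dominate distances on the curve.\<close>

lemma curve_length_plus_dist:
  assumes "a \<le> s" "s \<le> t"
  shows "curve_length g a s + ennreal (dist (g s) (g t)) \<le> curve_length g a t"
proof -
  have "(\<Sum>i < length ts - 1. ennreal (dist (g (ts ! i)) (g (ts ! Suc i)))) + ennreal (dist (g s) (g t))
        \<le> curve_length g a t" if ts: "sorted ts" "set ts \<subseteq> {a..s}" for ts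
  proof -
    \<comment> \<open>Inserting \<open>s\<close> isolates the distance from \<open>s\<close> to
      \<open>t\<close> as the last summand. The summand from the end of \<open>ts\<close> to
      \<open>s\<close> is dropped, which also covers empty \<open>ts\<close>.\<close>
    define us where "us = ts @ [s, t]"
    have "sorted us" using ts assms by (fastforce simp: us_def sorted_append)
    moreover have "set us \<subseteq> {a..t}" using ts assms by (auto simp: us_def)
    ultimately have *: "(\<Sum>i < length us - 1. ennreal (dist (g (us ! i)) (g (us ! Suc i)))) \<le> curve_length g a t"
      by (rule curve_length_upper)
    have l: "length us - 1 = Suc (length ts)" by (simp add: us_def)
    have "(\<Sum>i < length ts - 1. ennreal (dist (g (ts ! i)) (g (ts ! Suc i))))
        = (\<Sum>i < length ts - 1. ennreal (dist (g (us ! i)) (g (us ! Suc i))))"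
      by (intro sum.cong) (auto simp: us_def nth_append)
    also have "\<dots> \<le> (\<Sum>i < length ts. ennreal (dist (g (us ! i)) (g (us ! Suc i))))"
      by (intro sum_mono2) auto
    finally have "(\<Sum>i < length ts - 1. ennreal (dist (g (ts ! i)) (g (ts ! Suc i)))) + ennreal (dist (g s) (g t))
      \<le> (\<Sum>i < Suc (length ts). ennreal (dist (g (us ! i)) (g (us ! Suc i))))"
      by (simp add: us_def nth_append add_right_mono)
    with * show ?thesis unfolding l by (rule order_trans[rotated])
  qed
  then show ?thesis
    unfolding curve_length_def[of g a s]
    by (subst ennreal_SUP_add_left[symmetric]) (auto intro!: SUP_least exI[of _ "[]"])
qed

text \<open>The increments of \<open>V\<close> telescope along every partition.\<close>

lemma curve_length_le_control:
  assumes "a \<le> b" and V: "\<And>s t. a \<le> s \<Longrightarrow> s \<le> t \<Longrightarrow> t \<le> b \<Longrightarrow> dist (g s) (g t) \<le> V t - V s"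
  shows "curve_length g a b \<le> ennreal (V b - V a)"
  unfolding curve_length_def
proof (rule SUP_least)
  fix ts assume "ts \<in> {ts. sorted ts \<and> set ts \<subseteq> {a..b}}"
  then have ts: "sorted ts" "set ts \<subseteq> {a..b}" by auto
  have mono: "V s \<le> V t" if "a \<le> s" "s \<le> t" "t \<le> b" for s t
    using V[OF that] zero_le_dist[of "g s" "g t"] by linarith
  have bnd: "a \<le> ts ! i \<and> ts ! i \<le> b" if "i < length ts" for i
    using nth_mem[OF that] ts by auto
  have srt: "ts ! i \<le> ts ! Suc i" if "Suc i < length ts" for i
    using ts that by (simp add: sorted_iff_nth_Suc)
  show "(\<Sum>i < length ts - 1. ennreal (dist (g (ts ! i)) (g (ts ! Suc i)))) \<le> ennreal (V b - V a)"
  proof (cases "ts = []")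
    case False
    have "(\<Sum>i < length ts - 1. dist (g (ts ! i)) (g (ts ! Suc i)))
        \<le> (\<Sum>i < length ts - 1. V (ts ! Suc i) - V (ts ! i))"
      by (intro sum_mono V) (use bnd srt in auto)
    also have "\<dots> = V (ts ! (length ts - 1)) - V (ts ! 0)"
      by (rule sum_lessThan_telescope)
    also have "\<dots> \<le> V b - V a"
      using bnd[of 0] bnd[of "length ts - 1"] False by (intro diff_mono mono) auto
    finally show ?thesis
      by (subst sum_ennreal) (auto intro: ennreal_leI)
  qed (use assms mono in auto)
qed

section \<open>Arc length of a fixed continuous rectifiable curve\<close>

context
  fixes g :: "real \<Rightarrow> 'a::metric_space" and a b :: real
  assumes ab: "a \<le> b" and cont: "continuous_on {a..b} g" and rect: "rectifiable g a b"
begin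

abbreviation len :: "real \<Rightarrow> real" where "len t \<equiv> enn2real (curve_length g a t)"

lemma ennreal_len: "a \<le> t \<Longrightarrow> t \<le> b \<Longrightarrow> ennreal (len t) = curve_length g a t"
  using curve_length_plus_dist[of a t b g] rect
  by (intro ennreal_enn2real) (auto simp: rectifiable_def top_unique less_top[symmetric])

lemma dist_le_arc:
  assumes "a \<le> s" "s \<le> t" "t \<le> b"
  shows "dist (g s) (g t) \<le> len t - len s"
proof -
  have "ennreal (len s + dist (g s) (g t)) \<le> ennreal (len t)"
    using curve_length_plus_dist[of a s t g] assms
    by (simp add: ennreal_len)
  then show ?thesis by (subst (asm) ennreal_le_iff) auto
qed

lemma arc_mono: "a \<le> s \<Longrightarrow> s \<le> t \<Longrightarrow> t \<le> b \<Longrightarrow> len s \<le> len t"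
  using dist_le_arc[of s t] zero_le_dist[of "g s" "g t"] by linarith

text \<open>Arc length is the least function whose increments dominate distances;
  \<open>arc_surj\<close> gets its contradiction by constructing a smaller one.\<close>

lemma arc_le_control:
  assumes V: "\<And>s t. a \<le> s \<Longrightarrow> s \<le> t \<Longrightarrow> t \<le> b \<Longrightarrow> dist (g s) (g t) \<le> V t - V s"
  shows "len b \<le> V b - V a"
proof -
  have "0 \<le> V b - V a" using V[of a b] ab zero_le_dist[of "g a" "g b"] by linarith
  moreover have "curve_length g a b \<le> ennreal (V b - V a)"
    by (rule curve_length_le_control[OF ab]) (rule V)
  then have "ennreal (len b) \<le> ennreal (V b - V a)" using ennreal_len[of b] ab by simp
  ultimately show ?thesis by (subst (asm) ennreal_le_iff) auto
qed

text \<open>If the arc length skipped a value, the jump could be cut out, giving a smaller control.\<close>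

lemma arc_surj:
  assumes "\<sigma> \<in> {0..len b}"
  shows "\<exists>t\<in>{a..b}. len t = \<sigma>"
proof (rule ccontr)
  assume "\<not> ?thesis"
  then have ne: "\<And>t. t \<in> {a..b} \<Longrightarrow> len t \<noteq> \<sigma>" by auto
  define A where "A = {t\<in>{a..b}. len t < \<sigma>}"
  define t0 where "t0 = Sup A"
  have "len a < \<sigma>" using ne[of a] assms ab by auto
  then have aA: "a \<in> A" using ab by (auto simp: A_def)
  have bB: "\<sigma> < len b" using ne[of b] assms ab by auto
  have bdd: "bdd_above A" by (auto simp: A_def intro: bdd_aboveI[of _ b])
  have t0: "a \<le> t0" "t0 \<le> b"
    unfolding t0_def using aA by (intro cSup_upper bdd cSup_least; force simp: A_def)+
  have below: "len t < \<sigma>" if at: "a \<le> t" "t < t0" for t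
  proof -
    obtain u where "u \<in> A" "t < u"
      using at(2) less_cSup_iff[of A t] aA bdd by (auto simp: t0_def)
    then show ?thesis using arc_mono[of t u] that(1) by (auto simp: A_def)
  qed
  have above: "\<sigma> < len t" if "t0 < t" "t \<le> b" for t
  proof -
    have "t \<notin> A" using that(1) cSup_upper[OF _ bdd, of t] by (auto simp: t0_def)
    then show ?thesis using that t0 ne[of t] by (auto simp: A_def)
  qed
  have contt0: "\<exists>d>0. \<forall>t\<in>{a..b}. dist t t0 < d \<longrightarrow> dist (g t) (g t0) < e" if "e > 0" for e
    using cont t0 that by (auto simp: continuous_on_iff)
  show False
  \<comment> \<open>The skipped value \<open>\<sigma>\<close> is crossed at \<open>t0\<close>: arc
    length jumps immediately to the right of \<open>t0\<close> if \<open>t0 \<in> A\<close>, and on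
    arrival at \<open>t0\<close> otherwise.\<close>
  proof (cases "t0 \<in> A")
    case True
    then have lt: "len t0 < \<sigma>" by (auto simp: A_def)
    \<comment> \<open>Beyond \<open>t0\<close> the arc length exceeds \<open>\<sigma>\<close>, so
      the gap from \<open>len t0\<close> to \<open>\<sigma>\<close> can be removed. \<open>V\<close>
      still dominates distances across \<open>t0\<close>: by continuity of \<open>g\<close>, passing
      from \<open>t0\<close> to a nearby \<open>u\<close> costs at most \<open>e\<close>.\<close>
    define V where "V = (\<lambda>s. if s \<le> t0 then len s else len s - (\<sigma> - len t0))"
    have "t0 < b" using lt bB t0 by (cases "t0 = b") auto
    have "len b \<le> V b - V a"
    proof (rule arc_le_control)
      fix s t assume st: "a \<le> s" "s \<le> t" "t \<le> b"
      show "dist (g s) (g t) \<le> V t - V s"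
      proof (cases "s \<le> t0 \<and> t0 < t")
        case True
        show ?thesis
        proof (rule field_le_epsilon)
          fix e :: real assume "e > 0"
          from contt0[OF this] obtain d where d: "d > 0" "\<forall>t\<in>{a..b}. dist t t0 < d \<longrightarrow> dist (g t) (g t0) < e" by auto
          define u where "u = min t (t0 + d/2)"
          have u: "t0 < u" "u \<le> t" "dist u t0 < d" using True d by (auto simp: u_def dist_real_def)
          have "dist (g s) (g t) \<le> dist (g s) (g t0) + dist (g u) (g t0) + dist (g u) (g t)"
            using dist_triangle[of "g s" "g t" "g t0"] dist_triangle[of "g t0" "g t" "g u"]
            by (simp add: dist_commute)
          moreover have "dist (g s) (g t0) \<le> len t0 - len s" using True st t0 by (intro dist_le_arc) auto
          moreover have "dist (g u) (g t0) \<le> e" using d u st t0 by (intro less_imp_le) auto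
          moreover have "dist (g u) (g t) \<le> len t - len u" using u st t0 by (intro dist_le_arc) auto
          moreover have "\<sigma> < len u" using above[of u] u st by auto
          ultimately show "dist (g s) (g t) \<le> V t - V s + e" using True by (simp add: V_def)
        qed
      next
        case False
        then show ?thesis using st dist_le_arc[OF st] by (auto simp: V_def)
      qed
    qed
    then show False using t0 \<open>t0 < b\<close> lt by (auto simp: V_def)
  next
    case False
    then have gt: "len t0 > \<sigma>" using t0 ne[of t0] by (auto simp: A_def)
    \<comment> \<open>The mirror image: the gap from \<open>\<sigma>\<close> to
      \<open>len t0\<close> is removed from \<open>t0\<close> on, and \<open>u\<close> approaches
      \<open>t0\<close> from the left.\<close>
    define V where "V = (\<lambda>s. if s < t0 then len s else len s - (len t0 - \<sigma>))"
    have "a < t0" using False aA t0 by (cases "t0 = a") auto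
    have "len b \<le> V b - V a"
    proof (rule arc_le_control)
      fix s t assume st: "a \<le> s" "s \<le> t" "t \<le> b"
      show "dist (g s) (g t) \<le> V t - V s"
      proof (cases "s < t0 \<and> t0 \<le> t")
        case True
        show ?thesis
        proof (rule field_le_epsilon)
          fix e :: real assume "e > 0"
          from contt0[OF this] obtain d where d: "d > 0" "\<forall>t\<in>{a..b}. dist t t0 < d \<longrightarrow> dist (g t) (g t0) < e" by auto
          define u where "u = max s (t0 - d/2)"
          have u: "u < t0" "s \<le> u" "dist u t0 < d" using True d by (auto simp: u_def dist_real_def)
          have "dist (g s) (g t) \<le> dist (g s) (g u) + dist (g u) (g t0) + dist (g t0) (g t)"
            using dist_triangle[of "g s" "g t" "g u"] dist_triangle[of "g u" "g t" "g t0"]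
            by simp
          moreover have "dist (g s) (g u) \<le> len u - len s" using u True st t0 by (intro dist_le_arc) auto
          moreover have "dist (g u) (g t0) \<le> e" using d u st t0 by (intro less_imp_le) auto
          moreover have "dist (g t0) (g t) \<le> len t - len t0" using True st t0 by (intro dist_le_arc) auto
          moreover have "len u < \<sigma>" using below[of u] u st by auto
          ultimately show "dist (g s) (g t) \<le> V t - V s + e" using True by (simp add: V_def)
        qed
      next
        case False
        then show ?thesis using st dist_le_arc[OF st] by (auto simp: V_def)
      qed
    qed
    then show False using t0 \<open>a < t0\<close> gt by (auto simp: V_def)
  qed
qed

text \<open>Existence: \<open>g\<close> does not move while its arc length stands still, so the
  choice of parameter \<open>T\<close> is immaterial. Uniqueness: arc length takes every value in
  \<open>{0..len b}\<close>, and extensionality fixes the function elsewhere.\<close>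

lemma normal_rep_arc:
  assumes "t \<in> {a..b}"
  shows "normal_rep g a b (len t) = g t"
proof -
  let ?P = "\<lambda>h. h \<in> extensional {0..len b} \<and> (\<forall>t\<in>{a..b}. g t = h (len t))"
  obtain T where T: "\<And>\<sigma>. \<sigma> \<in> {0..len b} \<Longrightarrow> T \<sigma> \<in> {a..b} \<and> len (T \<sigma>) = \<sigma>"
    using arc_surj by metis
  have in_rng: "len t \<in> {0..len b}" if "t \<in> {a..b}" for t
    using that arc_mono[of t b] by auto
  have ex: "?P (restrict (\<lambda>\<sigma>. g (T \<sigma>)) {0..len b})"
  proof (intro conjI ballI)
    fix t assume t: "t \<in> {a..b}"
    have T': "T (len t) \<in> {a..b}" "len (T (len t)) = len t" using T[OF in_rng[OF t]] by auto
    have "dist (g t) (g (T (len t))) \<le> 0"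
    proof (cases "t \<le> T (len t)")
      case True
      then show ?thesis using dist_le_arc[of t "T (len t)"] T' t by auto
    next
      case False
      then show ?thesis using dist_le_arc[of "T (len t)" t] T' t by (auto simp: dist_commute)
    qed
    then show "g t = restrict (\<lambda>\<sigma>. g (T \<sigma>)) {0..len b} (len t)"
      using in_rng[OF t] by simp
  qed auto
  have uniq: "h = h'" if "?P h" "?P h'" for h h'
  proof (rule extensionalityI[of _ "{0..len b}"])
    fix \<sigma> assume "\<sigma> \<in> {0..len b}"
    then show "h \<sigma> = h' \<sigma>" using T[of \<sigma>] that by metis
  qed (use that in auto)
  have "?P (normal_rep g a b)"
    unfolding normal_rep_def by (rule theI[where P = ?P, OF ex]) (use uniq ex in blast)
  then show ?thesis using assms by auto
qed

lemma normal_rep_in_image: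
  assumes "\<sigma> \<in> {0..len b}"
  shows "normal_rep g a b \<sigma> \<in> g ` {a..b}"
  using arc_surj[OF assms] normal_rep_arc by force

lemma normal_rep_endpoints: "normal_rep g a b 0 = g a" "normal_rep g a b (len b) = g b"
  using normal_rep_arc[of a] normal_rep_arc[of b] ab by auto

lemma normal_rep_Lipschitz:
  assumes "\<sigma> \<in> {0..len b}" "\<tau> \<in> {0..len b}"
  shows "dist (normal_rep g a b \<sigma>) (normal_rep g a b \<tau>) \<le> \<bar>\<sigma> - \<tau>\<bar>"
proof -
  obtain s t where st: "s \<in> {a..b}" "t \<in> {a..b}" "len s = \<sigma>" "len t = \<tau>"
    using arc_surj assms by metis
  then have "normal_rep g a b \<sigma> = g s" "normal_rep g a b \<tau> = g t" using normal_rep_arc by auto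
  then show ?thesis
    using st dist_le_arc[of s t] dist_le_arc[of t s] by (cases "s \<le> t") (auto simp: dist_commute)
qed

end

section \<open>Images of sets under functions on an interval\<close>

text \<open>Cells of a dyadic covering are kept inside an open set barely larger than
  \<open>P\<close>, and being non-overlapping their lengths add up to at most its measure. Disjoint
  interiors serve absolute continuity, the mesh bound \<open>\<delta>\<close> serves local Lipschitz
  bounds.\<close>

lemma interval_cover:
  fixes P :: "real set"
  assumes P: "P \<subseteq> {a..b}" and "a < b" "\<epsilon> > 0" "\<delta> > 0"
  obtains c d :: "nat \<Rightarrow> real" where
    "\<And>i. a \<le> c i" "\<And>i. c i \<le> d i" "\<And>i. d i \<le> b" "\<And>i. d i - c i < \<delta>"
    "disjoint_family (\<lambda>i. {c i<..<d i})" "P \<subseteq> (\<Union>i. {c i..d i})"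
    "(\<Sum>i. ennreal (d i - c i)) \<le> outer_measure_of lebesgue P + ennreal \<epsilon>"
proof -
  obtain E where E: "E \<in> sets lebesgue" "P \<subseteq> E" "outer_measure_of lebesgue P = emeasure lebesgue E"
    using outer_measure_of_attain[of P lebesgue] by auto
  obtain T where T: "open T" "E \<subseteq> T" "T - E \<in> lmeasurable" "emeasure lebesgue (T - E) < ennreal \<epsilon>"
    using sets_lebesgue_outer_open[OF E(1) \<open>\<epsilon> > 0\<close>] .
  have eT: "emeasure lebesgue T \<le> emeasure lebesgue E + ennreal \<epsilon>"
  proof -
    have "emeasure lebesgue T = emeasure lebesgue (E \<union> (T - E))" using T by (simp add: Un_absorb1)
    also have "\<dots> \<le> emeasure lebesgue E + emeasure lebesgue (T - E)"
      using E T by (intro emeasure_subadditive) auto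
    also have "\<dots> \<le> emeasure lebesgue E + ennreal \<epsilon>" using T by (intro add_left_mono less_imp_le)
    finally show ?thesis .
  qed
  \<comment> \<open>Each cell lies in \<open>G x\<close> for some \<open>x\<close> in
    \<open>P\<close>, hence in \<open>T\<close> and in a ball of radius \<open>\<delta>/2\<close>.
    The value off \<open>T\<close> only completes the gauge.\<close>
  define G where "G = (\<lambda>x. if x \<in> T then ball x (\<delta>/2) \<inter> T else ball x 1)"
  have "x \<in> G x \<and> open (G x)" for x using T(1) \<open>\<delta> > 0\<close> by (simp add: G_def open_Int)
  then have gauge: "gauge G" by (simp add: gauge_def)
  have Pab: "P \<subseteq> cbox a b" and bne: "box a b \<noteq> {}" using P \<open>a < b\<close> by auto
  obtain \<D> where \<D>: "countable \<D>" "\<Union>\<D> \<subseteq> cbox a b"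
    "\<And>K. K \<in> \<D> \<Longrightarrow> interior K \<noteq> {} \<and> (\<exists>c d. K = cbox c d)"
    "pairwise (\<lambda>A B. interior A \<inter> interior B = {}) \<D>"
    "\<And>K. K \<in> \<D> \<Longrightarrow> \<exists>x \<in> P \<inter> K. K \<subseteq> G x"
    "\<And>u v. cbox u v \<in> \<D> \<Longrightarrow> \<exists>n. \<forall>i\<in>Basis. v \<bullet> i - u \<bullet> i = (b \<bullet> i - a \<bullet> i) / 2 ^ n" "P \<subseteq> \<Union>\<D>"
    by (rule covering_lemma[OF Pab bne gauge]) blast
  have "\<exists>c d. K = {c..d} \<and> c < d" if "K \<in> \<D>" for K
    using \<D>(3)[OF that] by (force simp: interior_atLeastAtMost_real)
  then obtain lo hi where lohi: "\<And>K. K \<in> \<D> \<Longrightarrow> K = {lo K..hi K} \<and> lo K < hi K" by metis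
  \<comment> \<open>The family may be finite: indices outside \<open>R\<close> receive the
    degenerate interval from \<open>a\<close> to \<open>a\<close>, whose length is 0 and whose
    interior is empty.\<close>
  define R where "R = to_nat_on \<D> ` \<D>"
  define X where "X = from_nat_into \<D>"
  have XD: "X i \<in> \<D>" if "i \<in> R" for i using that \<D>(1) by (auto simp: R_def X_def)
  have Xinj: "X i \<noteq> X j" if "i \<in> R" "j \<in> R" "i \<noteq> j" for i j
    using that \<D>(1) by (auto simp: R_def X_def)
  define c where "c = (\<lambda>i. if i \<in> R then lo (X i) else a)"
  define d where "d = (\<lambda>i. if i \<in> R then hi (X i) else a)"
  have Xcd: "X i = {c i..d i} \<and> c i < d i" if "i \<in> R" for i
    using lohi[OF XD[OF that]] that by (simp add: c_def d_def)
  have XT: "X i \<subseteq> T \<and> d i - c i < \<delta>" if i: "i \<in> R" for i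
  proof -
    obtain x where x: "x \<in> P" "X i \<subseteq> G x" using \<D>(5)[OF XD[OF i]] by auto
    then have "x \<in> T" using E T by auto
    then have *: "X i \<subseteq> ball x (\<delta>/2) \<inter> T" using x by (simp add: G_def)
    moreover have "c i \<in> X i" "d i \<in> X i" using Xcd[OF i] by auto
    ultimately have "dist x (c i) < \<delta>/2" "dist x (d i) < \<delta>/2" by auto
    then have "d i - c i < \<delta>" unfolding dist_real_def by linarith
    then show ?thesis using * by auto
  qed
  have dj: "disjoint_family (\<lambda>i. {c i<..<d i})"
    unfolding disjoint_family_on_def
  proof (intro ballI impI)
    fix i j :: nat assume "i \<noteq> j"
    show "{c i<..<d i} \<inter> {c j<..<d j} = {}"
    proof (cases "i \<in> R \<and> j \<in> R")
      case True
      then have "interior (X i) \<inter> interior (X j) = {}"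
        using pairwiseD[OF \<D>(4) XD XD] Xinj \<open>i \<noteq> j\<close> by auto
      then show ?thesis using Xcd True by (simp add: interior_atLeastAtMost_real)
    qed (auto simp: c_def d_def)
  qed
  show thesis
  proof (rule that)
    fix i
    have "a \<le> c i \<and> d i \<le> b \<and> c i \<le> d i \<and> d i - c i < \<delta>"
    proof (cases "i \<in> R")
      case True
      then have "X i \<subseteq> {a..b}" using XD[OF True] \<D>(2) by auto
      then have "{c i..d i} \<subseteq> {a..b}" "c i < d i" using Xcd[OF True] by auto
      then show ?thesis using XT[OF True] by auto
    qed (use \<open>a < b\<close> \<open>\<delta> > 0\<close> in \<open>simp add: c_def d_def\<close>)
    then show "a \<le> c i" "d i \<le> b" "c i \<le> d i" "d i - c i < \<delta>" by auto
  next
    show "disjoint_family (\<lambda>i. {c i<..<d i})" by (rule dj)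
    show "P \<subseteq> (\<Union>i. {c i..d i})"
    proof
      fix x assume "x \<in> P"
      then obtain K where K: "K \<in> \<D>" "x \<in> K" using \<D>(7) by auto
      then have "to_nat_on \<D> K \<in> R" "X (to_nat_on \<D> K) = K" using \<D>(1) by (auto simp: R_def X_def)
      then show "x \<in> (\<Union>i. {c i..d i})" using Xcd K by blast
    qed
    have cd: "c i \<le> d i" for i using Xcd[of i] by (cases "i \<in> R") (auto simp: c_def d_def)
    have "(\<Sum>i. ennreal (d i - c i)) = (\<Sum>i. emeasure lebesgue {c i<..<d i})"
      using cd by simp
    also have "\<dots> = emeasure lebesgue (\<Union>i. {c i<..<d i})"
      using dj by (intro suminf_emeasure) auto
    also have "\<dots> \<le> emeasure lebesgue T"
    proof (rule emeasure_mono)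
      show "(\<Union>i. {c i<..<d i}) \<subseteq> T"
      proof
        fix x assume "x \<in> (\<Union>i. {c i<..<d i})"
        then obtain i where i: "x \<in> {c i<..<d i}" by auto
        then have "i \<in> R" by (auto simp: c_def d_def split: if_splits)
        then show "x \<in> T" using XT[of i] Xcd[of i] i by (auto simp: subset_iff)
      qed
    qed (use T in auto)
    finally show "(\<Sum>i. ennreal (d i - c i)) \<le> outer_measure_of lebesgue P + ennreal \<epsilon>"
      using eT E by simp
  qed
qed

lemma outer_measure_of_UN_le:
  assumes "\<And>i. A i \<subseteq> space M"
  shows "outer_measure_of M (\<Union>i. A i) \<le> (\<Sum>i::nat. outer_measure_of M (A i))"
proof -
  have "\<exists>E. E \<in> sets M \<and> A i \<subseteq> E \<and> outer_measure_of M (A i) = emeasure M E" for i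
    using outer_measure_of_attain[OF assms[of i]] by auto
  then obtain E where E: "\<And>i. E i \<in> sets M" "\<And>i. A i \<subseteq> E i" "\<And>i. outer_measure_of M (A i) = emeasure M (E i)"
    by metis
  have "outer_measure_of M (\<Union>i. A i) \<le> outer_measure_of M (\<Union>i. E i)"
    using E by (intro outer_measure_of_mono) blast
  also have "\<dots> = emeasure M (\<Union>i. E i)" using E by (intro outer_measure_of_eq) auto
  also have "\<dots> \<le> (\<Sum>i. emeasure M (E i))" using E by (intro emeasure_subadditive_countably) auto
  finally show ?thesis by (simp add: E)
qed

lemma outer_measure_image_le_diam:
  fixes r :: "real \<Rightarrow> real"
  assumes "\<And>s t. s \<in> Q \<Longrightarrow> t \<in> Q \<Longrightarrow> \<bar>r s - r t\<bar> \<le> L" "0 \<le> L"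
  shows "outer_measure_of lebesgue (r ` Q) \<le> ennreal L"
proof (cases "Q = {}")
  case False
  then obtain q where q: "q \<in> Q" by auto
  have "\<bar>r s - r q\<bar> \<le> L" if "s \<in> Q" for s using assms(1)[OF that q] .
  then have bdd: "bdd_above (r ` Q)" "bdd_below (r ` Q)"
    by (auto intro!: bdd_aboveI[of _ "r q + L"] bdd_belowI[of _ "r q - L"] simp: abs_le_iff) (smt (verit))+
  have "Sup (r ` Q) \<le> Inf (r ` Q) + L"
  proof (rule cSup_least)
    fix x assume "x \<in> r ` Q"
    then obtain s where s: "s \<in> Q" "x = r s" by auto
    have "r s - L \<le> Inf (r ` Q)"
      using False by (intro cINF_greatest) (use assms(1)[OF s(1)] in \<open>auto simp: abs_le_iff\<close>, smt (verit))
    then show "x \<le> Inf (r ` Q) + L" using s by simp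
  qed (use False in auto)
  moreover have "Inf (r ` Q) \<le> Sup (r ` Q)" using bdd False by (intro cInf_le_cSup) auto
  moreover have "r ` Q \<subseteq> {Inf (r ` Q)..Sup (r ` Q)}"
    using bdd by (auto intro: cINF_lower cSUP_upper)
  then have "outer_measure_of lebesgue (r ` Q) \<le> outer_measure_of lebesgue {Inf (r ` Q)..Sup (r ` Q)}"
    by (rule outer_measure_of_mono)
  ultimately show ?thesis by (auto intro: order_trans ennreal_leI)
qed (simp add: outer_measure_of_eq)

text \<open>In a cover by intervals shorter than \<open>\<delta>\<close>, the image of each piece of
  \<open>P\<close> has diameter at most \<open>C\<close> times the length of its interval.\<close>

lemma outer_measure_image_locally_Lipschitz:
  fixes r :: "real \<Rightarrow> real"
  assumes P: "P \<subseteq> {a..b}" and "a < b" "0 \<le> C" "\<delta> > 0"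
    and lip: "\<And>s t. s \<in> P \<Longrightarrow> t \<in> P \<Longrightarrow> \<bar>s - t\<bar> < \<delta> \<Longrightarrow> \<bar>r s - r t\<bar> \<le> C * \<bar>s - t\<bar>"
  shows "outer_measure_of lebesgue (r ` P) \<le> ennreal C * outer_measure_of lebesgue P"
proof (rule ennreal_le_epsilon)
  fix e :: real assume e: "e > 0"
  \<comment> \<open>The summand 1 admits \<open>C = 0\<close> and still gives
    \<open>C * e' \<le> e\<close>.\<close>
  define e' where "e' = e / (C + 1)"
  have "e' > 0" using e \<open>0 \<le> C\<close> by (simp add: e'_def)
  from interval_cover[OF P \<open>a < b\<close> this \<open>\<delta> > 0\<close>] obtain c d where cd:
    "\<And>i. a \<le> c i" "\<And>i. c i \<le> d i" "\<And>i. d i \<le> b" "\<And>i. d i - c i < \<delta>"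
    "disjoint_family (\<lambda>i. {c i<..<d i})" "P \<subseteq> (\<Union>i. {c i..d i})"
    "(\<Sum>i. ennreal (d i - c i)) \<le> outer_measure_of lebesgue P + ennreal e'"
    by blast
  have "r ` P \<subseteq> (\<Union>i. r ` (P \<inter> {c i..d i}))" using cd(6) by blast
  then have "outer_measure_of lebesgue (r ` P) \<le> outer_measure_of lebesgue (\<Union>i. r ` (P \<inter> {c i..d i}))"
    by (rule outer_measure_of_mono)
  also have "\<dots> \<le> (\<Sum>i. outer_measure_of lebesgue (r ` (P \<inter> {c i..d i})))"
    by (intro outer_measure_of_UN_le) auto
  also have "\<dots> \<le> (\<Sum>i. ennreal (C * (d i - c i)))"
  proof (intro suminf_le summableI outer_measure_image_le_diam)
    fix i s t assume st: "s \<in> P \<inter> {c i..d i}" "t \<in> P \<inter> {c i..d i}"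
    then have *: "\<bar>s - t\<bar> \<le> d i - c i" by auto
    then have "\<bar>r s - r t\<bar> \<le> C * \<bar>s - t\<bar>" using st cd(4)[of i] by (intro lip) auto
    also have "\<dots> \<le> C * (d i - c i)" using * \<open>0 \<le> C\<close> by (intro mult_left_mono) auto
    finally show "\<bar>r s - r t\<bar> \<le> C * (d i - c i)" .
  qed (use cd(2) \<open>0 \<le> C\<close> in auto)
  also have "\<dots> = ennreal C * (\<Sum>i. ennreal (d i - c i))"
    using cd(2) \<open>0 \<le> C\<close> by (simp add: ennreal_mult)
  also have "\<dots> \<le> ennreal C * (outer_measure_of lebesgue P + ennreal e')"
    by (intro mult_left_mono cd) auto
  also have "\<dots> = ennreal C * outer_measure_of lebesgue P + ennreal (C * e')"
    using \<open>0 \<le> C\<close> \<open>e' > 0\<close> by (simp add: distrib_left ennreal_mult)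
  also have "\<dots> \<le> ennreal C * outer_measure_of lebesgue P + ennreal e"
    using \<open>0 \<le> C\<close> e by (intro add_left_mono ennreal_leI) (simp add: e'_def field_simps)
  finally show "outer_measure_of lebesgue (r ` P) \<le> ennreal C * outer_measure_of lebesgue P + ennreal e" .
qed

text \<open>Splitting \<open>E\<close> into level sets of \<open>M\<close> and then by the scale at which the growth bound sets in
  reduces the estimate to locally Lipschitz functions.\<close>

lemma outer_measure_image_le_growth:
  fixes r M :: "real \<Rightarrow> real"
  assumes E: "E \<in> sets lebesgue" "E \<subseteq> {a..b}" and "a < b"
    and M: "M \<in> borel_measurable lebesgue" "\<And>s. 0 \<le> M s"
    and growth: "\<And>s e. s \<in> E \<Longrightarrow> e > 0 \<Longrightarrow>
      \<exists>d>0. \<forall>t\<in>E. \<bar>t - s\<bar> < d \<longrightarrow> \<bar>r t - r s\<bar> \<le> (M s + e) * \<bar>t - s\<bar>"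
  shows "outer_measure_of lebesgue (r ` E) \<le> (\<integral>\<^sup>+s\<in>E. ennreal (M s) \<partial>lebesgue)"
proof (rule ennreal_le_epsilon)
  fix e0 :: real assume e0: "e0 > 0"
  \<comment> \<open>The constant used on the band \<open>Ej j\<close> exceeds \<open>M\<close> by at
    most \<open>2 * e\<close>; over a length of at most \<open>b - a\<close> this costs
    \<open>e0\<close>.\<close>
  define e where "e = e0 / (2 * (b - a))"
  have e: "e > 0" using e0 \<open>a < b\<close> by (simp add: e_def)
  define Ej where "Ej = (\<lambda>j::nat. {s \<in> E. real j * e \<le> M s \<and> M s < (real j + 1) * e})"
  \<comment> \<open>\<open>(real j + 2) * e\<close> is the upper bound of the band plus the slack
    \<open>e\<close> in \<open>growth\<close>.\<close>
  define Ejk where "Ejk = (\<lambda>j k::nat. {s \<in> Ej j. \<forall>t\<in>E. \<bar>t - s\<bar> < 1 / (real k + 1) \<longrightarrow>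
      \<bar>r t - r s\<bar> \<le> ((real j + 2) * e) * \<bar>t - s\<bar>})"
  have Ej: "Ej j \<in> sets lebesgue" for j
  proof -
    have "Ej j = E \<inter> {s \<in> space lebesgue. real j * e \<le> M s} \<inter> {s \<in> space lebesgue. M s < (real j + 1) * e}"
      by (auto simp: Ej_def)
    also have "\<dots> \<in> sets lebesgue" using E(1) M(1) by (intro sets.Int borel_measurable_le borel_measurable_less) auto
    finally show ?thesis .
  qed
  have UEj: "(\<Union>j. Ej j) = E"
  proof (intro equalityI subsetI)
    fix s assume s: "s \<in> E"
    define j where "j = nat \<lfloor>M s / e\<rfloor>"
    have "real j = of_int \<lfloor>M s / e\<rfloor>" using M(2)[of s] e by (simp add: j_def)
    then have "real j \<le> M s / e" "M s / e < real j + 1" by linarith+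
    then have "s \<in> Ej j" using s e by (simp add: Ej_def field_simps)
    then show "s \<in> (\<Union>j. Ej j)" by blast
  qed (auto simp: Ej_def)
  have djE: "disjoint_family Ej"
    unfolding disjoint_family_on_def
  proof (intro ballI impI)
    fix i j :: nat assume "i \<noteq> j"
    have False if "s \<in> Ej i" "s \<in> Ej j" for s
    proof -
      have "real i * e < (real j + 1) * e" "real j * e < (real i + 1) * e" using that by (auto simp: Ej_def)
      then have "real i < real j + 1" "real j < real i + 1" using e by auto
      then show False using \<open>i \<noteq> j\<close> by linarith
    qed
    then show "Ej i \<inter> Ej j = {}" by blast
  qed
  have piece: "outer_measure_of lebesgue (r ` Ej j) \<le> ennreal ((real j + 2) * e) * emeasure lebesgue (Ej j)" for j
  proof -
    have "(\<Union>k. Ejk j k) = Ej j"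
    proof (intro equalityI subsetI)
      fix s assume s: "s \<in> Ej j"
      then have sE: "s \<in> E" and Ms: "M s < (real j + 1) * e" by (auto simp: Ej_def)
      from growth[OF sE e] obtain d where d: "d > 0" "\<forall>t\<in>E. \<bar>t - s\<bar> < d \<longrightarrow> \<bar>r t - r s\<bar> \<le> (M s + e) * \<bar>t - s\<bar>"
        by auto
      obtain k :: nat where k: "1 / (real k + 1) < d"
        using reals_Archimedean[OF d(1)] by (auto simp: inverse_eq_divide add.commute)
      have "(M s + e) * \<bar>t - s\<bar> \<le> ((real j + 2) * e) * \<bar>t - s\<bar>" for t
        using Ms by (intro mult_right_mono) (auto simp: algebra_simps)
      then have "s \<in> Ejk j k" using s d k unfolding Ejk_def by (fastforce intro: order_trans)
      then show "s \<in> (\<Union>k. Ejk j k)" by blast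
    qed (auto simp: Ejk_def)
    then have "r ` Ej j = (\<Union>k. r ` Ejk j k)" by blast
    \<comment> \<open>Outer measure is continuous along increasing sequences of arbitrary sets, so
      neither \<open>Ejk j k\<close> nor its image has to be measurable.\<close>
    moreover have "incseq (\<lambda>k. r ` Ejk j k)"
    proof (intro incseq_SucI image_mono subsetI)
      fix k s assume s: "s \<in> Ejk j k"
      have "1 / (real (Suc k) + 1) \<le> 1 / (real k + 1)" by (simp add: frac_le)
      then show "s \<in> Ejk j (Suc k)" using s unfolding Ejk_def by fastforce
    qed
    ultimately have "outer_measure_of lebesgue (r ` Ej j) = (SUP k. outer_measure_of lebesgue (r ` Ejk j k))"
      by (subst SUP_outer_measure_of_incseq) auto
    also have "\<dots> \<le> ennreal ((real j + 2) * e) * emeasure lebesgue (Ej j)"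
    proof (rule SUP_least)
      fix k
      have "outer_measure_of lebesgue (r ` Ejk j k) \<le> ennreal ((real j + 2) * e) * outer_measure_of lebesgue (Ejk j k)"
      proof (rule outer_measure_image_locally_Lipschitz[where a=a and b=b and \<delta>="1 / (real k + 1)"])
        fix s t assume "s \<in> Ejk j k" "t \<in> Ejk j k" "\<bar>s - t\<bar> < 1 / (real k + 1)"
        moreover from this have "s \<in> E" by (auto simp: Ejk_def Ej_def)
        ultimately show "\<bar>r s - r t\<bar> \<le> (real j + 2) * e * \<bar>s - t\<bar>" by (auto simp: Ejk_def)
      qed (use E \<open>a < b\<close> e in \<open>auto simp: Ejk_def Ej_def\<close>)
      also have "\<dots> \<le> ennreal ((real j + 2) * e) * outer_measure_of lebesgue (Ej j)"
        by (intro mult_left_mono outer_measure_of_mono) (auto simp: Ejk_def)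
      finally show "outer_measure_of lebesgue (r ` Ejk j k) \<le> ennreal ((real j + 2) * e) * emeasure lebesgue (Ej j)"
        by (simp add: Ej)
    qed
    finally show ?thesis .
  qed
  have meas: "(\<lambda>s. ennreal (M s + 2 * e)) \<in> borel_measurable lebesgue" using M by measurable
  have "r ` E = (\<Union>j. r ` Ej j)" using UEj by blast
  then have "outer_measure_of lebesgue (r ` E) \<le> (\<Sum>j. outer_measure_of lebesgue (r ` Ej j))"
    by (simp add: outer_measure_of_UN_le)
  also have "\<dots> \<le> (\<Sum>j. ennreal ((real j + 2) * e) * emeasure lebesgue (Ej j))"
    by (intro suminf_le piece summableI)
  also have "\<dots> = (\<Sum>j. \<integral>\<^sup>+s. ennreal ((real j + 2) * e) * indicator (Ej j) s \<partial>lebesgue)"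
    using Ej by (simp add: nn_integral_cmult_indicator)
  also have "\<dots> \<le> (\<Sum>j. \<integral>\<^sup>+s. ennreal (M s + 2 * e) * indicator (Ej j) s \<partial>lebesgue)"
  proof (intro suminf_le summableI nn_integral_mono)
    fix j s
    have "(real j + 2) * e \<le> M s + 2 * e" if "s \<in> Ej j" using that by (simp add: Ej_def algebra_simps)
    then show "ennreal ((real j + 2) * e) * indicator (Ej j) s \<le> ennreal (M s + 2 * e) * indicator (Ej j) s"
      by (simp add: ennreal_leI del: distrib_right_numeral split: split_indicator)
  qed
  also have "\<dots> = (\<integral>\<^sup>+s. ennreal (M s + 2 * e) * indicator (\<Union>j. Ej j) s \<partial>lebesgue)"
    using Ej by (intro nn_integral_disjoint_family[symmetric] meas djE) auto
  also have "\<dots> = (\<integral>\<^sup>+s. ennreal (M s) * indicator E s + ennreal (2 * e) * indicator E s \<partial>lebesgue)"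
    unfolding UEj using M(2) e by (intro nn_integral_cong) (simp split: split_indicator)
  also have "\<dots> = (\<integral>\<^sup>+s\<in>E. ennreal (M s) \<partial>lebesgue) + ennreal (2 * e) * emeasure lebesgue E"
    using M E by (subst nn_integral_add) (auto simp: nn_integral_cmult_indicator)
  also have "\<dots> \<le> (\<integral>\<^sup>+s\<in>E. ennreal (M s) \<partial>lebesgue) + ennreal (2 * e) * ennreal (b - a)"
  proof (intro add_left_mono mult_left_mono)
    have "emeasure lebesgue E \<le> emeasure lebesgue {a..b}" using E by (intro emeasure_mono) auto
    then show "emeasure lebesgue E \<le> ennreal (b - a)" using \<open>a < b\<close> by simp
  qed auto
  also have "ennreal (2 * e) * ennreal (b - a) = ennreal e0"
  proof -
    have "2 * e * (b - a) = e0" using \<open>a < b\<close> by (simp add: e_def field_simps)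
    then show ?thesis using e \<open>a < b\<close> by (simp add: ennreal_mult[symmetric])
  qed
  finally show "outer_measure_of lebesgue (r ` E) \<le> (\<integral>\<^sup>+s\<in>E. ennreal (M s) \<partial>lebesgue) + ennreal e0" .
qed

section \<open>Absolutely continuous functions on an interval\<close>

lemma abs_contE:
  assumes "abs_cont F a b" "\<epsilon> > 0"
  obtains \<delta> where "\<delta> > 0"
    "\<And>(n::nat) u v. (\<And>i. i < n \<Longrightarrow> a \<le> u i \<and> u i \<le> v i \<and> v i \<le> b) \<Longrightarrow>
      disjoint_family_on (\<lambda>i. {u i<..<v i}) {..<n} \<Longrightarrow> (\<Sum>i<n. v i - u i) < \<delta> \<Longrightarrow>
      (\<Sum>i<n. dist (F (u i)) (F (v i))) < \<epsilon>"
proof -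
  obtain \<delta> where "\<delta> > 0" and D: "\<forall>(n::nat) u v.
        (\<forall>i<n. a \<le> u i \<and> u i \<le> v i \<and> v i \<le> b) \<and>
        disjoint_family_on (\<lambda>i. {u i<..<v i}) {..<n} \<and> (\<Sum>i<n. v i - u i) < \<delta> \<longrightarrow>
        (\<Sum>i<n. dist (F (u i)) (F (v i))) < \<epsilon>"
    using assms(1)[unfolded abs_cont_def, rule_format, OF assms(2)] by (elim exE conjE)
  show thesis
    by (rule that[OF \<open>\<delta> > 0\<close>], rule D[rule_format]) simp
qed

lemma abs_cont_imp_continuous_on:
  assumes "abs_cont F a b"
  shows "continuous_on {a..b} F"
proof (rule continuous_onI)
  fix x e :: real assume x: "x \<in> {a..b}" and "e > 0"
  obtain \<delta> where \<delta>: "\<delta> > 0"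
    and D: "\<And>(n::nat) u v. (\<And>i. i < n \<Longrightarrow> a \<le> u i \<and> u i \<le> v i \<and> v i \<le> b) \<Longrightarrow>
      disjoint_family_on (\<lambda>i. {u i<..<v i}) {..<n} \<Longrightarrow> (\<Sum>i<n. v i - u i) < \<delta> \<Longrightarrow>
      (\<Sum>i<n. dist (F (u i)) (F (v i))) < e"
    by (rule abs_contE[OF assms \<open>e > 0\<close>]) blast
  have "dist (F y) (F x) \<le> e" if "y \<in> {a..b}" "dist y x < \<delta>" for y
  proof (cases "x \<le> y")
    case True
    then show ?thesis using D[of 1 "\<lambda>_. x" "\<lambda>_. y"] that x
      by (simp add: disjoint_family_on_def dist_real_def dist_commute)
  next
    case False
    then show ?thesis using D[of 1 "\<lambda>_. y" "\<lambda>_. x"] that x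
      by (simp add: disjoint_family_on_def dist_real_def dist_commute)
  qed
  then show "\<exists>d>0. \<forall>y\<in>{a..b}. dist y x < d \<longrightarrow> dist (F y) (F x) \<le> e" using \<delta> by blast
qed

text \<open>The Luzin property of absolutely continuous functions: over a cover of small total
  length, the oscillations of \<open>r\<close> have a small sum.\<close>

lemma abs_cont_null_image:
  fixes r :: "real \<Rightarrow> real"
  assumes ac: "abs_cont r a b" and P: "P \<subseteq> {a..b}" "P \<in> null_sets lebesgue" and "a < b"
  shows "outer_measure_of lebesgue (r ` P) = 0"
proof -
  have "outer_measure_of lebesgue (r ` P) \<le> 0 + ennreal e" if "e > 0" for e
  proof -
    obtain \<delta> where \<delta>: "\<delta> > 0"
      and D: "\<And>(n::nat) u v. (\<And>i. i < n \<Longrightarrow> a \<le> u i \<and> u i \<le> v i \<and> v i \<le> b) \<Longrightarrow>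
        disjoint_family_on (\<lambda>i. {u i<..<v i}) {..<n} \<Longrightarrow> (\<Sum>i<n. v i - u i) < \<delta> \<Longrightarrow>
        (\<Sum>i<n. dist (r (u i)) (r (v i))) < e"
      by (rule abs_contE[OF ac \<open>e > 0\<close>]) blast
    have P0: "outer_measure_of lebesgue P = 0" using P by (auto simp: null_sets_def)
    have half: "\<delta>/2 > 0" using \<delta> by simp
    obtain c d where cd:
      "\<And>i. a \<le> c i" "\<And>i. c i \<le> d i" "\<And>i. d i \<le> b"
      "disjoint_family (\<lambda>i. {c i<..<d i})" "P \<subseteq> (\<Union>i. {c i..d i})"
      "(\<Sum>i. ennreal (d i - c i)) \<le> outer_measure_of lebesgue P + ennreal (\<delta>/2)"
      by (rule interval_cover[OF P(1) \<open>a < b\<close> half zero_less_one]) blast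
    \<comment> \<open>The oscillation on a covering interval is the increment between a maximum
      point and a minimum point, and increments are what \<open>abs_cont\<close> controls.\<close>
    have "\<exists>u v. c i \<le> u \<and> u \<le> v \<and> v \<le> d i \<and> (\<forall>s\<in>{c i..d i}. \<forall>t\<in>{c i..d i}. \<bar>r s - r t\<bar> \<le> dist (r u) (r v))" for i
    proof -
      have co: "continuous_on {c i..d i} r"
        using abs_cont_imp_continuous_on[OF ac] by (rule continuous_on_subset) (use cd(1,3) in auto)
      have ne: "{c i..d i} \<noteq> {}" using cd(2) by auto
      from continuous_attains_sup[OF compact_Icc ne co]
      obtain u where u: "u \<in> {c i..d i}" "\<And>t. t \<in> {c i..d i} \<Longrightarrow> r t \<le> r u" by blast
      from continuous_attains_inf[OF compact_Icc ne co]
      obtain v where v: "v \<in> {c i..d i}" "\<And>t. t \<in> {c i..d i} \<Longrightarrow> r v \<le> r t" by blast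
      have "\<bar>r s - r t\<bar> \<le> dist (r (min u v)) (r (max u v))" if "s \<in> {c i..d i}" "t \<in> {c i..d i}" for s t
        using u(2)[of s] u(2)[of t] v(2)[of s] v(2)[of t] that
        by (auto simp: dist_real_def min_def max_def)
      then show ?thesis using u(1) v(1) by (intro exI[of _ "min u v"] exI[of _ "max u v"]) auto
    qed
    then obtain u v where uv: "\<And>i. c i \<le> u i \<and> u i \<le> v i \<and> v i \<le> d i"
      and osc: "\<And>i s t. s \<in> {c i..d i} \<Longrightarrow> t \<in> {c i..d i} \<Longrightarrow> \<bar>r s - r t\<bar> \<le> dist (r (u i)) (r (v i))"
      by metis
    \<comment> \<open>\<open>abs_cont\<close> speaks of finite families only; a bound uniform in
      \<open>n\<close> passes to the infinite sum.\<close>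
    have fin: "(\<Sum>i<n. dist (r (u i)) (r (v i))) < e" for n
    proof (rule D, intro conjI allI impI)
      fix i show "a \<le> u i" "u i \<le> v i" "v i \<le> b" using uv[of i] cd(1-3)[of i] by linarith+
    next
      show "disjoint_family_on (\<lambda>i. {u i<..<v i}) {..<n}"
        unfolding disjoint_family_on_def
      proof (intro ballI impI)
        fix i j :: nat assume "i \<noteq> j"
        then have "{c i<..<d i} \<inter> {c j<..<d j} = {}" using cd(4) by (auto simp: disjoint_family_on_def)
        moreover have "{u i<..<v i} \<subseteq> {c i<..<d i}" "{u j<..<v j} \<subseteq> {c j<..<d j}"
          using uv[of i] uv[of j] by (auto simp: subset_iff)
        ultimately show "{u i<..<v i} \<inter> {u j<..<v j} = {}" by blast
      qed
      have "ennreal (\<Sum>i<n. d i - c i) = (\<Sum>i<n. ennreal (d i - c i))"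
        using cd(2) by (subst sum_ennreal) auto
      also have "\<dots> \<le> (\<Sum>i. ennreal (d i - c i))" by (rule sum_le_suminf) auto
      also have "\<dots> \<le> ennreal (\<delta>/2)" using cd(6) P0 by simp
      finally have "(\<Sum>i<n. d i - c i) \<le> \<delta>/2" using half by (subst (asm) ennreal_le_iff) auto
      moreover have "(\<Sum>i<n. v i - u i) \<le> (\<Sum>i<n. d i - c i)"
        by (intro sum_mono) (use uv in \<open>smt (verit)\<close>)
      ultimately show "(\<Sum>i<n. v i - u i) < \<delta>" using \<delta> by linarith
    qed
    have "r ` P \<subseteq> (\<Union>i. r ` {c i..d i})" using cd(5) by blast
    then have "outer_measure_of lebesgue (r ` P) \<le> outer_measure_of lebesgue (\<Union>i. r ` {c i..d i})"
      by (rule outer_measure_of_mono)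
    also have "\<dots> \<le> (\<Sum>i. outer_measure_of lebesgue (r ` {c i..d i}))"
      by (intro outer_measure_of_UN_le) auto
    also have "\<dots> \<le> (\<Sum>i. ennreal (dist (r (u i)) (r (v i))))"
      by (intro suminf_le summableI outer_measure_image_le_diam osc) auto
    also have "\<dots> \<le> ennreal e"
    proof (rule suminf_le_const[OF summableI])
      fix n show "(\<Sum>i<n. ennreal (dist (r (u i)) (r (v i)))) \<le> ennreal e"
        using fin[of n] by (subst sum_ennreal) (auto intro: ennreal_leI)
    qed
    finally show ?thesis by simp
  qed
  then have "outer_measure_of lebesgue (r ` P) \<le> 0" by (rule ennreal_le_epsilon)
  then show ?thesis by simp
qed

text \<open>A one-dimensional change of variables inequality: the hypothesis on \<open>M\<close> says that \<open>M\<close>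
  dominates \<open>\<bar>r'\<bar>\<close>, without asking for differentiability of \<open>r\<close>.\<close>

lemma nn_integral_le_along_abs_cont:
  fixes r M :: "real \<Rightarrow> real" and \<eta> :: "real \<Rightarrow> ennreal"
  assumes ac: "abs_cont r a b" and ab: "a < b" and r: "r a \<le> r1" "r2 \<le> r b"
    and T: "T \<in> sets borel" "T \<subseteq> {a..b}" "{a..b} - T \<in> null_sets lborel"
    and M: "M \<in> borel_measurable borel" "\<And>s. 0 \<le> M s"
    and \<eta>: "\<eta> \<in> borel_measurable borel"
    and growth: "\<And>s e. s \<in> T \<Longrightarrow> r1 < r s \<Longrightarrow> r s < r2 \<Longrightarrow> e > 0 \<Longrightarrow>
      \<exists>d>0. \<forall>t\<in>{a..b}. \<bar>t - s\<bar> < d \<longrightarrow> \<bar>r t - r s\<bar> \<le> (M s + e) * \<bar>t - s\<bar>"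
  shows "(\<integral>\<^sup>+x\<in>{r1<..<r2}. \<eta> x \<partial>lborel) \<le>
    (\<integral>\<^sup>+s\<in>T. \<eta> (r s) * indicator {r1<..<r2} (r s) * ennreal (M s) \<partial>lborel)"
proof -
  \<comment> \<open>Clamping the argument extends \<open>r\<close> continuously to the whole line,
    which makes it Borel.\<close>
  define R where "R = (\<lambda>s. r (max a (min b s)))"
  have cr: "continuous_on {a..b} r" by (rule abs_cont_imp_continuous_on[OF ac])
  have "continuous_on UNIV R"
    unfolding R_def
    by (rule continuous_on_compose2[OF cr]) (use ab in \<open>auto intro!: continuous_intros\<close>)
  then have R: "R \<in> borel_measurable borel" by (rule borel_measurable_continuous_onI)
  have Rr: "R s = r s" if "s \<in> T" for s
  proof -
    have "max a (min b s) = s" using that T(2) by auto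
    then show ?thesis by (simp add: R_def)
  qed
  define W where "W = (\<lambda>s. ennreal (M s) * indicator T s)"
  have W: "W \<in> borel_measurable lborel" using M T by (auto simp: W_def)
  \<comment> \<open>\<open>\<mu>\<close> is the image under \<open>r\<close> of the measure with
    density \<open>M\<close> on \<open>T\<close>, and \<open>\<nu>\<close> is Lebesgue measure on
    (r1,r2). Once \<open>\<nu> \<le> \<mu>\<close> holds on Borel sets, it can be integrated against
    any Borel \<open>\<eta>\<close>, infinite values included.\<close>
  define \<mu> where "\<mu> = distr (density lborel W) borel R"
  define \<nu> where "\<nu> = density lborel (indicator {r1<..<r2} :: real \<Rightarrow> ennreal)"
  have s\<mu>: "sets \<mu> = sets borel" and s\<nu>: "sets \<nu> = sets borel" by (auto simp: \<mu>_def \<nu>_def)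
  have "emeasure \<nu> B \<le> emeasure \<mu> B" if B: "B \<in> sets borel" for B
  proof -
    define B' where "B' = B \<inter> {r1<..<r2}"
    have B': "B' \<in> sets borel" using B by (auto simp: B'_def)
    define E where "E = T \<inter> (R -` B' \<inter> space borel)"
    have E: "E \<in> sets borel" using T R B' unfolding E_def by (intro sets.Int measurable_sets) auto
    have Er: "E = {s \<in> T. r s \<in> B'}" using Rr by (auto simp: E_def)
    \<comment> \<open>By the intermediate value theorem every level in (r1,r2) is attained; levels
      attained only outside \<open>T\<close> form a null set.\<close>
    have "B' \<subseteq> r ` E \<union> r ` ({a..b} - T)"
    proof
      fix x assume x: "x \<in> B'"
      then have "r a \<le> x" "x \<le> r b" using r by (auto simp: B'_def)
      then obtain s where "a \<le> s" "s \<le> b" "r s = x" using IVT'[of r a x b] cr ab by auto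
      then show "x \<in> r ` E \<union> r ` ({a..b} - T)" using x by (cases "s \<in> T") (auto simp: Er)
    qed
    then have "outer_measure_of lebesgue B' \<le> outer_measure_of lebesgue (r ` E \<union> r ` ({a..b} - T))"
      by (rule outer_measure_of_mono)
    \<comment> \<open>The union of two sets is written as a sequence so that countable subadditivity
      applies; repeating the second set is harmless because its outer measure is 0.\<close>
    also have "\<dots> = outer_measure_of lebesgue (\<Union>i::nat. (\<lambda>i. if i = 0 then r ` E else r ` ({a..b} - T)) i)"
      by (rule arg_cong[where f="outer_measure_of lebesgue"]) (auto split: if_splits)
    also have "\<dots> \<le> (\<Sum>i::nat. outer_measure_of lebesgue (if i = 0 then r ` E else r ` ({a..b} - T)))"
      by (rule outer_measure_of_UN_le) auto
    also have "\<dots> = (\<Sum>i::nat. if i = 0 then outer_measure_of lebesgue (r ` E) else 0)"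
    proof -
      have "outer_measure_of lebesgue (r ` ({a..b} - T)) = 0"
        using T(3) by (intro abs_cont_null_image[OF ac _ _ ab]) (auto intro: null_sets_completionI)
      then show ?thesis by (intro suminf_cong) auto
    qed
    also have "\<dots> = outer_measure_of lebesgue (r ` E)"
      by (subst suminf_finite[of "{0}"]) auto
    also have "\<dots> \<le> (\<integral>\<^sup>+s\<in>E. ennreal (M s) \<partial>lebesgue)"
    proof (rule outer_measure_image_le_growth[where a=a and b=b])
      show "M \<in> borel_measurable lebesgue" using M(1) by (simp add: measurable_completion)
      show "E \<in> sets lebesgue" using E by simp
      fix s e :: real assume "s \<in> E" "e > 0"
      moreover from this have "s \<in> T" "r1 < r s" "r s < r2" by (auto simp: Er B'_def)
      ultimately obtain d where "d > 0" "\<forall>t\<in>{a..b}. \<bar>t - s\<bar> < d \<longrightarrow> \<bar>r t - r s\<bar> \<le> (M s + e) * \<bar>t - s\<bar>"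
        using growth by blast
      moreover have "E \<subseteq> {a..b}" using T by (auto simp: Er)
      ultimately show "\<exists>d>0. \<forall>t\<in>E. \<bar>t - s\<bar> < d \<longrightarrow> \<bar>r t - r s\<bar> \<le> (M s + e) * \<bar>t - s\<bar>" by blast
    qed (use ab M T in \<open>auto simp: Er\<close>)
    also have "\<dots> = (\<integral>\<^sup>+s\<in>E. ennreal (M s) \<partial>lborel)"
      by (rule nn_integral_completion)
    also have "\<dots> \<le> (\<integral>\<^sup>+s\<in>R -` B \<inter> space lborel. W s \<partial>lborel)"
      by (intro nn_integral_mono) (auto simp: W_def E_def B'_def split: split_indicator)
    also have "\<dots> = emeasure (density lborel W) (R -` B \<inter> space lborel)"
      using W R B measurable_sets[of R borel borel B] by (simp add: emeasure_density)
    also have "\<dots> = emeasure \<mu> B"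
      unfolding \<mu>_def using R B by (simp add: emeasure_distr)
    also have "outer_measure_of lebesgue B' = emeasure \<nu> B"
    proof -
      have "emeasure \<nu> B = (\<integral>\<^sup>+x. indicator ({r1<..<r2} \<inter> B) x \<partial>lborel)"
        using B by (simp add: \<nu>_def emeasure_density indicator_inter_arith del: nn_integral_indicator)
      also have "\<dots> = emeasure lborel ({r1<..<r2} \<inter> B)" using B by (intro nn_integral_indicator) auto
      finally have "emeasure \<nu> B = emeasure lborel ({r1<..<r2} \<inter> B)" .
      then show ?thesis using B' by (simp add: B'_def Int_commute)
    qed
    finally show ?thesis .
  qed
  then have "\<nu> \<le> \<mu>" by (subst le_measure) (auto simp: s\<mu> s\<nu>)
  then have le: "(\<integral>\<^sup>+x. \<eta> x * indicator {r1<..<r2} x \<partial>\<nu>) \<le> (\<integral>\<^sup>+x. \<eta> x * indicator {r1<..<r2} x \<partial>\<mu>)"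
    by (intro nn_integral_mono_measure) (auto simp: s\<mu> s\<nu>)
  have "(\<integral>\<^sup>+x\<in>{r1<..<r2}. \<eta> x \<partial>lborel) = (\<integral>\<^sup>+x. indicator {r1<..<r2} x * (\<eta> x * indicator {r1<..<r2} x) \<partial>lborel)"
    by (intro nn_integral_cong) (auto split: split_indicator)
  also have "\<dots> = (\<integral>\<^sup>+x. \<eta> x * indicator {r1<..<r2} x \<partial>\<nu>)"
    unfolding \<nu>_def using \<eta> by (subst nn_integral_density) auto
  also note le
  also have "(\<integral>\<^sup>+x. \<eta> x * indicator {r1<..<r2} x \<partial>\<mu>) =
      (\<integral>\<^sup>+s. W s * (\<eta> (R s) * indicator {r1<..<r2} (R s)) \<partial>lborel)"
  proof -
    have *: "(\<lambda>s. \<eta> (R s) * indicator {r1<..<r2} (R s)) \<in> borel_measurable borel"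
      using R \<eta> by measurable
    show ?thesis
      unfolding \<mu>_def using \<eta> R W * by (subst nn_integral_distr) (auto simp: nn_integral_density)
  qed
  also have "\<dots> = (\<integral>\<^sup>+s\<in>T. \<eta> (r s) * indicator {r1<..<r2} (r s) * ennreal (M s) \<partial>lborel)"
    by (intro nn_integral_cong) (auto simp: W_def Rr mult_ac split: split_indicator)
  finally show ?thesis .
qed

section \<open>Change of variables with multiplicity\<close>

lemma finite_sum_le_infsum_ennreal:
  fixes u :: "'a \<Rightarrow> ennreal"
  assumes "finite F" "F \<subseteq> A"
  shows "sum u F \<le> infsum u A"
  unfolding nonneg_infsum_complete[OF zero_le] by (intro SUP_upper) (use assms in auto)

lemma infsum_le_ennreal:
  fixes u :: "'a \<Rightarrow> ennreal"
  assumes "\<And>F. finite F \<Longrightarrow> F \<subseteq> A \<Longrightarrow> sum u F \<le> c"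
  shows "infsum u A \<le> c"
  unfolding nonneg_infsum_complete[OF zero_le] by (intro SUP_least) (use assms in auto)

text \<open>On \<open>G\<close> the preimage of a point meets each piece of an injectivity partition at most once.\<close>

lemma suminf_inverse_branches_le_infsum:
  fixes u :: "'a \<Rightarrow> ennreal" and S :: "nat \<Rightarrow> 'a set"
  assumes dj: "disjoint_family S" and inj: "\<And>i. inj_on f (S i)" and sub: "\<And>i. S i \<subseteq> G"
  shows "(\<Sum>i. u (the_inv_into (S i) f y) * indicator (f ` S i) y) \<le> (\<Sum>\<^sub>\<infinity>x\<in>{x \<in> G. f x = y}. u x)"
proof (rule suminf_le_const[OF summableI])
  fix n
  let ?h = "\<lambda>i. the_inv_into (S i) f y"
  define I where "I = {i \<in> {..<n}. y \<in> f ` S i}"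
  have h: "?h i \<in> S i" "f (?h i) = y" if "i \<in> I" for i
    using that inj[of i] by (auto simp: I_def the_inv_into_f_f)
  have "inj_on ?h I"
  proof (rule inj_onI)
    fix i j assume "i \<in> I" "j \<in> I" "?h i = ?h j"
    then have "?h i \<in> S i \<inter> S j" using h(1) by (metis IntI)
    then show "i = j" using dj by (auto simp: disjoint_family_on_def)
  qed
  have "(\<Sum>i<n. u (?h i) * indicator (f ` S i) y) = (\<Sum>i\<in>I. u (?h i))"
    unfolding I_def by (intro sum.mono_neutral_cong_right) auto
  also have "\<dots> = sum u (?h ` I)" using \<open>inj_on ?h I\<close> by (simp add: sum.reindex)
  also have "\<dots> \<le> (\<Sum>\<^sub>\<infinity>x\<in>{x \<in> G. f x = y}. u x)"
  proof (rule finite_sum_le_infsum_ennreal)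
    show "finite (?h ` I)" by (simp add: I_def)
    show "?h ` I \<subseteq> {x \<in> G. f x = y}" using h sub by blast
  qed
  finally show "(\<Sum>i<n. u (?h i) * indicator (f ` S i) y) \<le> (\<Sum>\<^sub>\<infinity>x\<in>{x \<in> G. f x = y}. u x)" .
qed

text \<open>If the image has finite measure, the change of variables theorem gives equality;
  otherwise the right-hand side is infinite.\<close>

lemma nn_integral_abs_det_le_emeasure_image:
  fixes f :: "real^'n::{finite,wellorder} \<Rightarrow> real^'n::_"
  assumes S: "S \<in> sets lebesgue"
    and der: "\<And>x. x \<in> S \<Longrightarrow> (f has_derivative f' x) (at x within S)"
    and inj: "inj_on f S"
  shows "(\<integral>\<^sup>+x\<in>S. ennreal \<bar>det (matrix (f' x))\<bar> \<partial>lebesgue) \<le> emeasure lebesgue (f ` S)"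
proof (cases "f ` S \<in> lmeasurable")
  case True
  then have "((\<lambda>x. \<bar>det (matrix (f' x))\<bar>) has_integral measure lebesgue (f ` S)) S"
    using has_measure_differentiable_image[OF assms] by auto
  then have "(\<integral>\<^sup>+x\<in>S. ennreal \<bar>det (matrix (f' x))\<bar> \<partial>lborel) = ennreal (measure lebesgue (f ` S))"
    by (intro nn_integral_has_integral_lebesgue') auto
  then show ?thesis using True by (simp add: nn_integral_completion emeasure_eq_measure2)
next
  case False
  have "f differentiable_on S" using der by (auto simp: differentiable_on_def differentiable_def)
  then have "f ` S \<in> sets lebesgue" using S by (intro differentiable_image_in_sets_lebesgue) auto
  then have "emeasure lebesgue (f ` S) = \<infinity>" using False by (simp add: fmeasurable_def not_less top_unique)
  then show ?thesis by simp
qed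

lemma
  fixes f :: "real^'n::{finite,wellorder} \<Rightarrow> real^'n::_" and F :: "real^'n::_ \<Rightarrow> ennreal"
  assumes S: "S \<in> sets lebesgue"
    and der: "\<And>x. x \<in> S \<Longrightarrow> (f has_derivative f' x) (at x within S)"
    and inj: "inj_on f S"
    and nz: "\<And>x. x \<in> S \<Longrightarrow> det (matrix (f' x)) \<noteq> 0"
    and F: "F \<in> borel_measurable (lebesgue_on S)"
  defines "u \<equiv> \<lambda>x. F x / ennreal \<bar>det (matrix (f' x))\<bar>"
  shows borel_measurable_inverse_branch:
      "(\<lambda>y. u (the_inv_into S f y) * indicator (f ` S) y) \<in> borel_measurable lebesgue"
    and nn_integral_le_inverse_branch:
      "(\<integral>\<^sup>+x\<in>S. F x \<partial>lebesgue) \<le> (\<integral>\<^sup>+y\<in>f ` S. u (the_inv_into S f y) \<partial>lebesgue)"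
proof -
  let ?h = "the_inv_into S f" and ?J = "\<lambda>x. ennreal \<bar>det (matrix (f' x))\<bar>"
  have J: "?J \<in> borel_measurable (lebesgue_on S)"
    using borel_measurable_det_Jacobian[OF S der] by measurable
  have u: "u \<in> borel_measurable (lebesgue_on S)"
    unfolding u_def using F J by measurable
  have diff: "f differentiable_on E" if "E \<subseteq> S" for E
    using der that unfolding differentiable_on_def differentiable_def by (meson has_derivative_subset subsetD)
  have im: "f ` E \<in> sets lebesgue" if "E \<in> sets lebesgue" "E \<subseteq> S" for E
    using that diff by (intro differentiable_image_in_sets_lebesgue) auto
  \<comment> \<open>Preimages under the inverse branch are images under \<open>f\<close>, and a
    differentiable map between spaces of equal dimension keeps sets Lebesgue measurable. The branch
    is thus measurable for the Lebesgue sigma-algebras on both sides.\<close>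
  have hpre: "?h -` E \<inter> f ` S = f ` E" if "E \<subseteq> S" for E
  proof (intro equalityI subsetI)
    fix y assume "y \<in> ?h -` E \<inter> f ` S"
    then have "?h y \<in> E" "f (?h y) = y" using inj by (auto simp: f_the_inv_into_f)
    then show "y \<in> f ` E" by (metis imageI)
  next
    fix y assume "y \<in> f ` E"
    then show "y \<in> ?h -` E \<inter> f ` S" using that inj by (auto simp: the_inv_into_f_f subset_iff)
  qed
  have setsS: "E \<in> sets (lebesgue_on S) \<longleftrightarrow> E \<in> sets lebesgue \<and> E \<subseteq> S" for E
    using S by (auto simp: sets_restrict_space_iff)
  have h: "?h \<in> measurable (lebesgue_on (f ` S)) (lebesgue_on S)"
  proof (rule measurableI)
    fix y assume "y \<in> space (lebesgue_on (f ` S))"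
    then show "?h y \<in> space (lebesgue_on S)" using inj by (auto simp: the_inv_into_f_f)
  next
    fix E assume "E \<in> sets (lebesgue_on S)"
    then have E: "E \<in> sets lebesgue" "E \<subseteq> S" by (auto simp: setsS)
    then show "?h -` E \<inter> space (lebesgue_on (f ` S)) \<in> sets (lebesgue_on (f ` S))"
      using im[OF E] im[OF S] by (simp add: hpre sets_restrict_space_iff image_mono)
  qed
  have uh: "(\<lambda>y. u (?h y)) \<in> borel_measurable (lebesgue_on (f ` S))"
    using measurable_compose[OF h u] .
  then show "(\<lambda>y. u (?h y) * indicator (f ` S) y) \<in> borel_measurable lebesgue"
    using im[OF S] by (subst (asm) borel_measurable_restrict_space_iff_ennreal) auto
  define \<nu> where "\<nu> = density (lebesgue_on S) ?J"
  define \<mu> where "\<mu> = distr (lebesgue_on (f ` S)) (lebesgue_on S) ?h"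
  have "emeasure \<nu> E \<le> emeasure \<mu> E" if "E \<in> sets (lebesgue_on S)" for E
  proof -
    have E: "E \<in> sets lebesgue" "E \<subseteq> S" using that by (auto simp: setsS)
    have "emeasure \<nu> E = (\<integral>\<^sup>+x. ?J x * indicator E x * indicator S x \<partial>lebesgue)"
      unfolding \<nu>_def using J that S by (simp add: emeasure_density nn_integral_restrict_space)
    also have "\<dots> = (\<integral>\<^sup>+x\<in>E. ?J x \<partial>lebesgue)"
      using E by (intro nn_integral_cong) (auto split: split_indicator)
    also have "\<dots> \<le> emeasure lebesgue (f ` E)"
      using E der inj by (intro nn_integral_abs_det_le_emeasure_image)
        (auto intro: has_derivative_subset inj_on_subset)
    also have "\<dots> = emeasure \<mu> E"
      unfolding \<mu>_def using h that E im[OF S]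
      by (simp add: emeasure_distr hpre emeasure_restrict_space image_mono)
    finally show ?thesis .
  qed
  then have "\<nu> \<le> \<mu>" by (subst le_measure) (auto simp: \<mu>_def \<nu>_def)
  then have le: "nn_integral \<nu> u \<le> nn_integral \<mu> u"
    by (intro nn_integral_mono_measure) (auto simp: \<mu>_def \<nu>_def)
  have Fu: "F x = ?J x * u x" if "x \<in> S" for x
  proof -
    have "?J x \<noteq> 0" "?J x \<noteq> \<infinity>" using nz[OF that] by auto
    then show ?thesis by (simp add: u_def ennreal_times_divide ennreal_mult_divide_eq mult.commute)
  qed
  have "(\<integral>\<^sup>+x\<in>S. F x \<partial>lebesgue) = (\<integral>\<^sup>+x. F x \<partial>lebesgue_on S)"
    using S by (simp add: nn_integral_restrict_space)
  also have "\<dots> = (\<integral>\<^sup>+x. ?J x * u x \<partial>lebesgue_on S)"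
    using Fu by (intro nn_integral_cong) auto
  also have "\<dots> = nn_integral \<nu> u" unfolding \<nu>_def using J u by (simp add: nn_integral_density)
  also note le
  also have "nn_integral \<mu> u = (\<integral>\<^sup>+y. u (?h y) \<partial>lebesgue_on (f ` S))"
    unfolding \<mu>_def using h u by (simp add: nn_integral_distr)
  also have "\<dots> = (\<integral>\<^sup>+y\<in>f ` S. u (?h y) \<partial>lebesgue)"
    using im[OF S] by (simp add: nn_integral_restrict_space)
  finally show "(\<integral>\<^sup>+x\<in>S. F x \<partial>lebesgue) \<le> (\<integral>\<^sup>+y\<in>f ` S. u (?h y) \<partial>lebesgue)" .
qed

text \<open>An injective derivative at \<open>x\<close> bounds \<bar>f z - f x\<bar> below by a
  multiple of \<bar>z - x\<bar> for nearby \<open>z\<close>. Where constant and scale can be chosen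
  uniformly, \<open>f\<close> is injective on every set of diameter below that scale.\<close>

lemma injective_pieces:
  fixes f :: "'a::euclidean_space \<Rightarrow> 'b::euclidean_space"
  assumes G: "G \<in> sets lebesgue"
    and der: "\<And>x. x \<in> G \<Longrightarrow> (f has_derivative f' x) (at x within G)"
    and injd: "\<And>x. x \<in> G \<Longrightarrow> inj (f' x)"
  shows "\<exists>S :: nat \<Rightarrow> 'a set. (\<forall>i. S i \<in> sets lebesgue \<and> inj_on f (S i)) \<and>
    disjoint_family S \<and> (\<Union>i. S i) = G"
proof -
  have contf: "continuous_on G f"
    using der has_derivative_continuous by (force simp: continuous_on_eq_continuous_within)
  \<comment> \<open>For fixed \<open>z\<close> the condition on \<open>x\<close> is relatively
    closed, so \<open>A k\<close>, an intersection over all \<open>z\<close> in \<open>G\<close>, is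
    relatively closed and hence measurable.\<close>
  define K where "K = (\<lambda>(k::nat) z. {x \<in> G. 1 / (real k + 1) \<le> dist z x} \<union> {x \<in> G. dist z x \<le> (real k + 1) * dist (f z) (f x)})"
  define A where "A = (\<lambda>k::nat. {x \<in> G. \<forall>z\<in>G. x \<in> K k z})"
  have K: "closedin (top_of_set G) (K k z)" for k z
  proof -
    have "closedin (top_of_set G) (G \<inter> (\<lambda>x. dist z x) -` {1 / (real k + 1)..})"
      by (intro continuous_closedin_preimage continuous_intros)
    moreover have "closedin (top_of_set G) (G \<inter> (\<lambda>x. dist z x - (real k + 1) * dist (f z) (f x)) -` {..0})"
      by (intro continuous_closedin_preimage continuous_intros contf)
    moreover have "K k z = (G \<inter> (\<lambda>x. dist z x) -` {1 / (real k + 1)..}) \<union>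
        (G \<inter> (\<lambda>x. dist z x - (real k + 1) * dist (f z) (f x)) -` {..0})"
      by (auto simp: K_def)
    ultimately show ?thesis by (metis closedin_Un)
  qed
  have A: "A k \<in> sets lebesgue" for k
  proof -
    have "closedin (top_of_set G) (A k)"
    proof (cases "G = {}")
      case False
      then have "A k = (\<Inter>z\<in>G. K k z)" by (auto simp: A_def K_def)
      then show ?thesis using K False by (auto intro: closedin_INT)
    qed (simp add: A_def)
    then obtain C where "closed C" "A k = G \<inter> C" by (auto simp: closedin_closed)
    then show ?thesis using G by auto
  qed
  have UA: "\<exists>k. x \<in> A k" if x: "x \<in> G" for x
  proof -
    have "linear (f' x)" using der[OF x] by (rule has_derivative_linear)
    then obtain B where B: "B > 0" "\<And>v. B * norm v \<le> norm (f' x v)"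
      using linear_inj_bounded_below_pos[OF _ injd[OF x]] by metis
    obtain d where d: "d > 0" "\<And>z. z \<in> G \<Longrightarrow> norm (z - x) < d \<Longrightarrow>
        norm (f z - f x - f' x (z - x)) \<le> B / 2 * norm (z - x)"
      using der[OF x] B(1) unfolding has_derivative_within_alt by (meson half_gt_zero)
    \<comment> \<open>The bound \<open>1/d\<close> places the scale \<open>1 / (real k + 1)\<close>
      below \<open>d\<close>. The bound \<open>2/B\<close> matches the lower slope
      \<open>B/2\<close> that remains of \<open>B\<close> after the error term of the
      derivative.\<close>
    obtain k :: nat where k: "max (1/d) (2/B) < real k" using reals_Archimedean2 by blast
    have "z \<in> G \<Longrightarrow> x \<in> K k z" for z
    proof (cases "1 / (real k + 1) \<le> dist z x")
      case False
      assume z: "z \<in> G"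
      have "1 / (real k + 1) < d" using k d(1) by (simp add: field_simps)
      then have "norm (f z - f x - f' x (z - x)) \<le> B / 2 * norm (z - x)"
        using False z by (intro d) (auto simp: dist_norm)
      then have "B / 2 * norm (z - x) \<le> norm (f z - f x)"
        using B(2)[of "z - x"] norm_triangle_ineq2[of "f' x (z - x)" "f' x (z - x) - (f z - f x)"]
          norm_minus_commute[of "f z - f x" "f' x (z - x)"] by (simp add: algebra_simps)
      then have "dist z x \<le> 2 / B * dist (f z) (f x)" using B(1) by (simp add: dist_norm field_simps)
      also have "\<dots> \<le> (real k + 1) * dist (f z) (f x)" using k by (intro mult_right_mono) auto
      finally show ?thesis using x by (simp add: K_def)
    qed (use x in \<open>simp add: K_def\<close>)
    then show ?thesis using x by (auto simp: A_def)
  qed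
  obtain Q :: "'a set" where Q: "countable Q" "\<And>X. open X \<Longrightarrow> X \<noteq> {} \<Longrightarrow> \<exists>q\<in>Q. q \<in> X"
    using countable_dense_exists by blast
  then have "Q \<noteq> {}" using open_UNIV by blast
  \<comment> \<open>Two points of such a ball are less than \<open>1 / (real k + 1)\<close> apart,
    the scale at which the lower bound on \<open>A k\<close> applies.\<close>
  define P where "P = (\<lambda>(k, m). A k \<inter> ball (from_nat_into Q m) (1 / (2 * (real k + 1))))"
  define S where "S = disjointed (\<lambda>i. P (prod_decode i))"
  have P: "P c \<in> sets lebesgue" for c using A by (cases c) (auto simp: P_def)
  have PG: "P c \<subseteq> G" for c by (cases c) (auto simp: P_def A_def)
  have injP: "inj_on f (P c)" for c
  proof (rule inj_onI)
    obtain k m where c: "c = (k, m)" by (cases c)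
    fix x z assume xz: "x \<in> P c" "z \<in> P c" "f x = f z"
    then have "dist z x < 1 / (2 * (real k + 1)) + 1 / (2 * (real k + 1))"
      by (intro dist_triangle_less_add[of z "from_nat_into Q m"]) (auto simp: P_def c dist_commute)
    then have "dist z x < 1 / (real k + 1)" by (simp add: field_simps)
    moreover have "x \<in> K k z" using xz by (auto simp: P_def c A_def)
    ultimately have "dist z x \<le> 0" using xz(3) by (auto simp: K_def)
    then show "x = z" by simp
  qed
  show ?thesis
  proof (intro exI[of _ S] conjI allI)
    show "S i \<in> sets lebesgue" for i
      using P unfolding S_def disjointed_def by (intro sets.Diff sets.finite_UN) auto
    show "disjoint_family S" unfolding S_def by (rule disjoint_family_disjointed)
    show "inj_on f (S i)" for i
      unfolding S_def by (rule inj_on_subset[OF injP disjointed_subset])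
    have "(\<Union>i. S i) = (\<Union>i. P (prod_decode i))" unfolding S_def by (rule UN_disjointed_eq)
    also have "\<dots> = G"
    proof (intro equalityI subsetI)
      fix x assume "x \<in> G"
      then obtain k where k: "x \<in> A k" using UA by blast
      obtain q where "q \<in> Q" "q \<in> ball x (1 / (2 * (real k + 1)))"
        using Q(2)[of "ball x (1 / (2 * (real k + 1)))"] by auto
      then have "x \<in> P (k, to_nat_on Q q)"
        using k Q(1) by (simp add: P_def dist_commute)
      then have "x \<in> P (prod_decode (prod_encode (k, to_nat_on Q q)))" by simp
      then show "x \<in> (\<Union>i. P (prod_decode i))" by blast
    qed (use PG in blast)
    finally show "(\<Union>i. S i) = G" .
  qed
qed

text \<open>Only the inequality of the area formula with multiplicity that is insensitive to the
  measurability of the right-hand integrand: for such integrands \<open>nn_integral\<close> is a lower integral.\<close>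

lemma nn_integral_le_nn_integral_infsum_preimage:
  fixes f :: "real^'n::{finite,wellorder} \<Rightarrow> real^'n::_" and F :: "real^'n::_ \<Rightarrow> ennreal"
  assumes G: "G \<in> sets lebesgue"
    and der: "\<And>x. x \<in> G \<Longrightarrow> (f has_derivative f' x) (at x within G)"
    and nz: "\<And>x. x \<in> G \<Longrightarrow> det (matrix (f' x)) \<noteq> 0"
    and F: "F \<in> borel_measurable lebesgue"
  shows "(\<integral>\<^sup>+x\<in>G. F x \<partial>lebesgue) \<le>
    (\<integral>\<^sup>+y. (\<Sum>\<^sub>\<infinity>x\<in>{x \<in> G. f x = y}. F x / ennreal \<bar>det (matrix (f' x))\<bar>) \<partial>lebesgue)"
proof -
  let ?u = "\<lambda>x. F x / ennreal \<bar>det (matrix (f' x))\<bar>"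
  have injd: "inj (f' x)" if "x \<in> G" for x
    using nz[OF that] der[OF that] by (simp add: det_nz_iff_inj has_derivative_linear)
  obtain S where SS: "(\<forall>i::nat. S i \<in> sets lebesgue \<and> inj_on f (S i)) \<and>
      disjoint_family S \<and> (\<Union>i. S i) = G"
    by (rule exE[OF injective_pieces[of G f f', OF G der injd]])
  then have S: "\<And>i. S i \<in> sets lebesgue" "disjoint_family S" "(\<Union>i. S i) = G" "\<And>i. inj_on f (S i)"
    by auto
  have SG: "S i \<subseteq> G" for i using S(3) by auto
  have derS: "(f has_derivative f' x) (at x within S i)" if "x \<in> S i" for i x
    using der SG[of i] that by (blast intro: has_derivative_subset)
  have nzS: "det (matrix (f' x)) \<noteq> 0" if "x \<in> S i" for i x using nz SG that by blast
  have FS: "F \<in> borel_measurable (lebesgue_on (S i))" for i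
    using F by (rule measurable_restrict_space1)
  note branch = S(1) derS S(4) nzS FS
  have "(\<integral>\<^sup>+x\<in>G. F x \<partial>lebesgue) = (\<Sum>i. \<integral>\<^sup>+x\<in>S i. F x \<partial>lebesgue)"
    unfolding S(3)[symmetric] by (intro nn_integral_disjoint_family F S)
  also have "\<dots> \<le> (\<Sum>i. \<integral>\<^sup>+y\<in>f ` S i. ?u (the_inv_into (S i) f y) \<partial>lebesgue)"
    by (intro suminf_le summableI nn_integral_le_inverse_branch branch)
  also have "\<dots> = (\<integral>\<^sup>+y. (\<Sum>i. ?u (the_inv_into (S i) f y) * indicator (f ` S i) y) \<partial>lebesgue)"
    by (intro nn_integral_suminf[symmetric] borel_measurable_inverse_branch branch)
  also have "\<dots> \<le> (\<integral>\<^sup>+y. (\<Sum>\<^sub>\<infinity>x\<in>{x \<in> G. f x = y}. ?u x) \<partial>lebesgue)"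
    by (intro nn_integral_mono suminf_inverse_branches_le_infsum S SG)
  finally show ?thesis .
qed

section \<open>Modulus and admissibility\<close>

lemma ennpowr_measurable [measurable]:
  assumes [measurable]: "\<rho> \<in> borel_measurable M"
  shows "(\<lambda>x. ennpowr (\<rho> x) p) \<in> borel_measurable M"
  unfolding ennpowr_def by measurable

lemma ennpowr_0 [simp]: "ennpowr 0 p = 0"
  by (simp add: ennpowr_def)

lemma ennpowr_ennreal: "0 \<le> r \<Longrightarrow> ennpowr (ennreal r) p = ennreal (r powr p)"
  by (simp add: ennpowr_def)

lemma ennpowr_mono:
  assumes "0 \<le> p" "x \<le> y"
  shows "ennpowr x p \<le> ennpowr y p"
proof (cases "y = \<infinity>")
  case False
  then have "x \<noteq> \<infinity>" "enn2real x \<le> enn2real y"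
    using assms by (auto simp: top_unique less_top intro: enn2real_mono)
  then show ?thesis using False assms by (auto simp: ennpowr_def intro!: ennreal_leI powr_mono2)
qed (simp add: ennpowr_def)

text \<open>The case \<open>x = \<infinity>\<close>, \<open>r = 0\<close> is included, since
  \<open>\<infinity> * 0 = 0\<close> and \<open>0 powr p = 0\<close>; it occurs where
  \<open>\<eta>\<close> is infinite and the radial stretch vanishes.\<close>

lemma ennpowr_mult_ennreal:
  assumes "0 \<le> r"
  shows "ennpowr (x * ennreal r) p = ennpowr x p * ennreal (r powr p)"
proof (cases x)
  case (real s)
  then show ?thesis using assms
    by (simp add: ennreal_mult[symmetric] ennpowr_ennreal powr_mult)
next
  case top
  then show ?thesis using assms by (cases "r = 0") (auto simp: ennpowr_def ennreal_top_mult)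
qed

lemma line_integral_mono:
  assumes "\<And>x. \<rho> x \<le> \<sigma> x"
  shows "line_integral \<rho> c \<le> line_integral \<sigma> c"
proof (cases c)
  case (Pair I g)
  show ?thesis unfolding Pair line_integral.simps
    by (intro SUP_mono) (use assms in \<open>force intro!: nn_integral_mono mult_right_mono\<close>)
qed

text \<open>An exceptional family of modulus zero has admissible densities of arbitrarily small
  energy. The maximum of \<open>\<rho>\<close> and such a density is admissible for all of
  \<open>\<Gamma>\<close>, and the p-th power of a maximum is at most the sum of the p-th
  powers.\<close>

lemma modulus_le_nn_integral:
  assumes \<rho>: "\<rho> \<in> borel_measurable borel" and \<Gamma>: "\<Gamma> \<subseteq> curves_in D"
    and P: "almost_all_curves p D P"
    and adm: "\<And>c. c \<in> \<Gamma> \<Longrightarrow> locally_rectifiable c \<Longrightarrow> P c \<Longrightarrow> 1 \<le> line_integral \<rho> c"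
  shows "modulus p \<Gamma> \<le> (\<integral>\<^sup>+x. ennpowr (\<rho> x) p \<partial>lborel)"
proof (rule ennreal_le_epsilon)
  fix e :: real assume "e > 0"
  obtain \<Gamma>0 where \<Gamma>0: "modulus p \<Gamma>0 = 0" "\<forall>c \<in> curves_in D - \<Gamma>0. P c"
    using P by (auto simp: almost_all_curves_def)
  have "(INF \<rho>\<in>admissible \<Gamma>0. \<integral>\<^sup>+x. ennpowr (\<rho> x) p \<partial>lborel) < ennreal e"
    using \<Gamma>0(1) \<open>e > 0\<close> by (simp add: modulus_def)
  then obtain \<rho>' where \<rho>': "\<rho>' \<in> admissible \<Gamma>0" "(\<integral>\<^sup>+x. ennpowr (\<rho>' x) p \<partial>lborel) < ennreal e"
    by (auto simp: INF_less_iff)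
  then have \<rho>'m: "\<rho>' \<in> borel_measurable borel" by (simp add: admissible_def)
  define \<sigma> where "\<sigma> = (\<lambda>x. max (\<rho> x) (\<rho>' x))"
  have "\<sigma> \<in> borel_measurable borel" using \<rho> \<rho>'m by (simp add: \<sigma>_def)
  moreover have "1 \<le> line_integral \<sigma> c" if c: "c \<in> \<Gamma>" "locally_rectifiable c" for c
  proof (cases "c \<in> \<Gamma>0")
    case True
    then have "1 \<le> line_integral \<rho>' c" using \<rho>'(1) c by (simp add: admissible_def)
    also have "\<dots> \<le> line_integral \<sigma> c" by (rule line_integral_mono) (simp add: \<sigma>_def)
    finally show ?thesis .
  next
    case False
    then have "1 \<le> line_integral \<rho> c" using adm c \<Gamma>0(2) \<Gamma> by blast
    also have "\<dots> \<le> line_integral \<sigma> c" by (rule line_integral_mono) (simp add: \<sigma>_def)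
    finally show ?thesis .
  qed
  ultimately have "\<sigma> \<in> admissible \<Gamma>" by (simp add: admissible_def)
  then have "modulus p \<Gamma> \<le> (\<integral>\<^sup>+x. ennpowr (\<sigma> x) p \<partial>lborel)"
    unfolding modulus_def by (rule INF_lower)
  also have "\<dots> \<le> (\<integral>\<^sup>+x. ennpowr (\<rho> x) p + ennpowr (\<rho>' x) p \<partial>lborel)"
    by (intro nn_integral_mono) (auto simp: \<sigma>_def max_def)
  also have "\<dots> = (\<integral>\<^sup>+x. ennpowr (\<rho> x) p \<partial>lborel) + (\<integral>\<^sup>+x. ennpowr (\<rho>' x) p \<partial>lborel)"
    using \<rho> \<rho>'m by (intro nn_integral_add) auto
  also have "\<dots> \<le> (\<integral>\<^sup>+x. ennpowr (\<rho> x) p \<partial>lborel) + ennreal e"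
    using \<rho>'(2) by (intro add_left_mono less_imp_le)
  finally show "modulus p \<Gamma> \<le> (\<integral>\<^sup>+x. ennpowr (\<rho> x) p \<partial>lborel) + ennreal e" .
qed

text \<open>Where \<open>f\<close> is differentiable and \<open>f x\<close> differs from
  \<open>y0\<close>, this is the operator norm of the derivative of \<bar>f - y0\<bar> at
  \<open>x\<close>. It is written exactly as the base of the power in
  \<open>cotangent_dilatation\<close>, so that the two unfold to the same term.\<close>

definition radial_stretch ::
    "(real^'n \<Rightarrow> real^'n) \<Rightarrow> real^'n \<Rightarrow> real^'n \<Rightarrow> real" where
  "radial_stretch f y0 x =
     (SUP h\<in>sphere 0 1. \<bar>frechet_derivative f (at x) h \<bullet> ((f x - y0) /\<^sub>R norm (f x - y0))\<bar>)"

lemma Sup_abs_inner_sphere: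
  fixes w :: "'a::euclidean_space"
  shows "(SUP h\<in>sphere 0 1. \<bar>w \<bullet> h\<bar>) = norm w"
proof (rule antisym)
  have bound: "\<bar>w \<bullet> h\<bar> \<le> norm w" if "h \<in> sphere 0 1" for h
    using Cauchy_Schwarz_ineq2[of w h] that by simp
  have ne: "(SOME b::'a. b \<in> Basis) \<in> sphere 0 1" by (simp add: some_in_eq SOME_Basis)
  then show "(SUP h\<in>sphere 0 1. \<bar>w \<bullet> h\<bar>) \<le> norm w" by (intro cSUP_least bound) auto
  have bdd: "bdd_above ((\<lambda>h. \<bar>w \<bullet> h\<bar>) ` sphere 0 1)" using bound by (auto intro!: bdd_aboveI2)
  show "norm w \<le> (SUP h\<in>sphere 0 1. \<bar>w \<bullet> h\<bar>)"
  proof (cases "w = 0")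
    case False
    then have "sgn w \<in> sphere 0 1" "\<bar>w \<bullet> sgn w\<bar> = norm w"
      by (simp_all add: norm_sgn sgn_div_norm dot_square_norm power2_eq_square)
    then show ?thesis using cSUP_upper[OF _ bdd, of "sgn w"] by simp
  next
    case True
    then show ?thesis using cSUP_upper[OF ne bdd] by simp
  qed
qed

text \<open>Moving the derivative to the other side of the scalar product replaces the supremum over
  the sphere by the norm of a vector built from partial derivatives, whose measurability in
  \<open>x\<close> is accessible.\<close>

lemma
  fixes f :: "real^'n \<Rightarrow> real^'n"
  assumes "f differentiable (at x)"
  shows radial_stretch_eq_norm: "radial_stretch f y0 x =
      norm (sgn (f x - y0) v* matrix (frechet_derivative f (at x)))"
    and frechet_derivative_inner_le: "\<bar>frechet_derivative f (at x) h \<bullet> sgn (f x - y0)\<bar>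
      \<le> radial_stretch f y0 x * norm h"
proof -
  let ?f' = "frechet_derivative f (at x)" and ?w = "sgn (f x - y0) v* matrix (frechet_derivative f (at x))"
  have "(f has_derivative ?f') (at x)" using assms frechet_derivative_works by blast
  then have lin: "linear ?f'" by (rule has_derivative_linear)
  have eq: "?f' h \<bullet> sgn (f x - y0) = ?w \<bullet> h" for h
  proof -
    have "?f' h = matrix ?f' *v h" using matrix_vector_mul(2)[OF lin] by metis
    then have "?f' h \<bullet> sgn (f x - y0) = sgn (f x - y0) \<bullet> (matrix ?f' *v h)" by (metis inner_commute)
    then show ?thesis by (simp only: dot_lmul_matrix)
  qed
  show *: "radial_stretch f y0 x = norm ?w"
    unfolding radial_stretch_def sgn_div_norm[symmetric] eq by (rule Sup_abs_inner_sphere)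
  show "\<bar>?f' h \<bullet> sgn (f x - y0)\<bar> \<le> radial_stretch f y0 x * norm h"
    unfolding * eq by (rule Cauchy_Schwarz_ineq2)
qed

text \<open>The chain rule applies because the norm is differentiable away from 0. The bound holds
  for all \<open>z\<close> near \<open>x\<close>, so points of any curve through \<open>x\<close>
  may be inserted.\<close>

lemma dist_image_growth:
  fixes f :: "real^'n \<Rightarrow> real^'n"
  assumes diff: "f differentiable (at x)" and ne: "f x \<noteq> y0" and "e > 0"
  shows "\<exists>d>0. \<forall>z. dist z x < d \<longrightarrow>
    \<bar>dist (f z) y0 - dist (f x) y0\<bar> \<le> (radial_stretch f y0 x + e) * dist z x"
proof -
  let ?f' = "frechet_derivative f (at x)"
  have "(f has_derivative ?f') (at x)" using diff frechet_derivative_works by blast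
  then have "((\<lambda>z. f z - y0) has_derivative ?f') (at x)" by (auto intro!: derivative_eq_intros)
  from has_derivative_compose[OF this has_derivative_norm] ne
  have "((\<lambda>z. norm (f z - y0)) has_derivative (\<lambda>h. ?f' h \<bullet> sgn (f x - y0))) (at x)" by simp
  then obtain d where d: "d > 0" "\<And>z. norm (z - x) < d \<Longrightarrow>
      norm (norm (f z - y0) - norm (f x - y0) - ?f' (z - x) \<bullet> sgn (f x - y0)) \<le> e * norm (z - x)"
    using \<open>e > 0\<close> unfolding has_derivative_at_alt by blast
  show ?thesis
  proof (intro exI[of _ d] conjI allI impI d(1))
    fix z assume "dist z x < d"
    then have "\<bar>norm (f z - y0) - norm (f x - y0) - ?f' (z - x) \<bullet> sgn (f x - y0)\<bar> \<le> e * norm (z - x)"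
      using d(2) by (simp add: dist_norm)
    moreover have "\<bar>?f' (z - x) \<bullet> sgn (f x - y0)\<bar> \<le> radial_stretch f y0 x * norm (z - x)"
      by (rule frechet_derivative_inner_le[OF diff])
    ultimately show "\<bar>dist (f z) y0 - dist (f x) y0\<bar> \<le> (radial_stretch f y0 x + e) * dist z x"
      by (simp add: dist_norm distrib_right)
  qed
qed

lemma abs_cont_dist:
  assumes "abs_cont F a b"
  shows "abs_cont (\<lambda>s. dist (F s) y) a b"
  unfolding abs_cont_def
proof (intro allI impI)
  fix \<epsilon> :: real assume "\<epsilon> > 0"
  obtain \<delta> where \<delta>: "\<delta> > 0"
    and D: "\<And>(n::nat) u v. (\<And>i. i < n \<Longrightarrow> a \<le> u i \<and> u i \<le> v i \<and> v i \<le> b) \<Longrightarrow>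
      disjoint_family_on (\<lambda>i. {u i<..<v i}) {..<n} \<Longrightarrow> (\<Sum>i<n. v i - u i) < \<delta> \<Longrightarrow>
      (\<Sum>i<n. dist (F (u i)) (F (v i))) < \<epsilon>"
    by (rule abs_contE[OF assms \<open>\<epsilon> > 0\<close>]) blast
  show "\<exists>\<delta>>0. \<forall>(n::nat) u v. (\<forall>i<n. a \<le> u i \<and> u i \<le> v i \<and> v i \<le> b) \<and>
        disjoint_family_on (\<lambda>i. {u i<..<v i}) {..<n} \<and> (\<Sum>i<n. v i - u i) < \<delta> \<longrightarrow>
        (\<Sum>i<n. dist (dist (F (u i)) y) (dist (F (v i)) y)) < \<epsilon>"
  proof (intro exI[of _ \<delta>] conjI allI impI \<delta>)
    fix n :: nat and u v
    assume *: "(\<forall>i<n. a \<le> u i \<and> u i \<le> v i \<and> v i \<le> b) \<and>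
        disjoint_family_on (\<lambda>i. {u i<..<v i}) {..<n} \<and> (\<Sum>i<n. v i - u i) < \<delta>"
    have "(\<Sum>i<n. dist (dist (F (u i)) y) (dist (F (v i)) y)) \<le> (\<Sum>i<n. dist (F (u i)) (F (v i)))"
    proof (rule sum_mono)
      fix i
      show "dist (dist (F (u i)) y) (dist (F (v i)) y) \<le> dist (F (u i)) (F (v i))"
        using dist_triangle[of "F (u i)" y "F (v i)"] dist_triangle[of "F (v i)" y "F (u i)"]
        by (simp add: dist_real_def dist_commute abs_le_iff)
    qed
    also have "\<dots> < \<epsilon>" using * by (intro D) auto
    finally show "(\<Sum>i<n. dist (dist (F (u i)) y) (dist (F (v i)) y)) < \<epsilon>" .
  qed
qed

text \<open>The value \<open>\<infinity>\<close> on the null set \<open>N\<close> disposes of all curves that meet \<open>N\<close> in positive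
  length, without an appeal to the exceptional family of curves they form.\<close>

lemma line_integral_ge_1:
  fixes f :: "real^'n \<Rightarrow> real^'n"
  assumes c: "(I, g) \<in> preimage_family D f y0 r1 r2" "locally_rectifiable (I, g)"
      "locally_abs_cont_on f (I, g)"
    and r: "0 < r1" "r1 < r2"
    and N: "N \<in> sets borel"
    and \<Lambda>: "\<Lambda> \<in> borel_measurable borel" "\<And>x. 0 \<le> \<Lambda> x"
    and good: "\<And>x. x \<in> D \<Longrightarrow> x \<notin> N \<Longrightarrow> f differentiable (at x)"
      "\<And>x. x \<in> D \<Longrightarrow> x \<notin> N \<Longrightarrow> \<Lambda> x = radial_stretch f y0 x"
    and \<eta>: "\<eta> \<in> borel_measurable borel" "1 \<le> (\<integral>\<^sup>+s\<in>{r1<..<r2}. \<eta> s \<partial>lborel)"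
    and \<rho>N: "\<And>x. x \<in> N \<Longrightarrow> \<rho> x = \<infinity>"
    and \<rho>: "\<And>x. x \<in> D \<Longrightarrow> x \<notin> N \<Longrightarrow>
      \<rho> x = \<eta> (dist (f x) y0) * indicator {r1<..<r2} (dist (f x) y0) * ennreal (\<Lambda> x)"
  shows "1 \<le> line_integral \<rho> (I, g)"
proof -
  obtain a b where ab: "a \<le> b" "I = {a..b}" and ends: "f (g a) \<in> sphere y0 r1" "f (g b) \<in> sphere y0 r2"
    using c(1) by (auto simp: preimage_family_def joining_curves_def)
  have g: "continuous_on {a..b} g" "g ` {a..b} \<subseteq> D"
    using c(1) ab by (auto simp: preimage_family_def curves_in_def)
  have rect: "rectifiable g a b" using c(2) ab by auto
  define l where "l = enn2real (curve_length g a b)"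
  define h where "h = normal_rep g a b"
  note nr = ab(1) g(1) rect
  have lip: "dist (h s) (h t) \<le> \<bar>s - t\<bar>" if "s \<in> {0..l}" "t \<in> {0..l}" for s t
    using normal_rep_Lipschitz[OF nr] that by (simp add: h_def l_def)
  have hD: "h s \<in> D" if "s \<in> {0..l}" for s
    using normal_rep_in_image[OF nr] that g(2) by (auto simp: h_def l_def)
  have l0: "0 \<le> l" by (simp add: l_def)
  have "abs_cont (f \<circ> h) 0 l"
    using c(3) ab rect by (auto simp: abs_cont_on_curve_def h_def l_def)
  then have ac: "abs_cont (\<lambda>s. dist (f (h s)) y0) 0 l"
    using abs_cont_dist[of "f \<circ> h"] by (simp add: o_def)
  have e0: "dist (f (h 0)) y0 = r1" and el: "dist (f (h l)) y0 = r2"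
    using normal_rep_endpoints[OF nr] ends by (auto simp: h_def l_def dist_commute)
  have "0 < l" using l0 e0 el r by (cases "l = 0") auto
  \<comment> \<open>As before, clamping gives a continuous extension, here of the normal
    representation, so that preimages of Borel sets are Borel.\<close>
  define H where "H = (\<lambda>s. h (max 0 (min l s)))"
  have "continuous_on {0..l} h"
  proof (rule continuous_onI)
    fix x e :: real assume x: "x \<in> {0..l}" and "e > 0"
    show "\<exists>d>0. \<forall>x'\<in>{0..l}. dist x' x < d \<longrightarrow> dist (h x') (h x) \<le> e"
    proof (intro exI[of _ e] conjI ballI impI \<open>e > 0\<close>)
      fix x' assume "x' \<in> {0..l}" "dist x' x < e"
      then show "dist (h x') (h x) \<le> e" using lip[of x' x] x by (simp add: dist_real_def)
    qed
  qed
  then have "continuous_on UNIV H"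
    unfolding H_def
    by (rule continuous_on_compose2) (use l0 in \<open>auto intro!: continuous_intros\<close>)
  then have H: "H \<in> borel_measurable borel" by (rule borel_measurable_continuous_onI)
  have Hh: "H s = h s" if "s \<in> {0..l}" for s
  proof -
    have "max 0 (min l s) = s" using that by auto
    then show ?thesis by (simp add: H_def)
  qed
  define T where "T = {0..l} - H -` N"
  have T: "T \<in> sets borel" unfolding T_def using measurable_sets_borel[OF H N] by auto
  have Ts: "s \<in> {0..l}" "h s \<in> D" "h s \<notin> N" if "s \<in> T" for s
    using that hD[of s] Hh[of s] by (auto simp: T_def)
  have "1 \<le> (\<integral>\<^sup>+s\<in>{0..l}. \<rho> (h s) \<partial>lborel)"
  proof (cases "{0..l} - T \<in> null_sets lborel")
    case False
    have "{0..l} - T \<in> sets lborel" using T by auto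
    then have "emeasure lborel ({0..l} - T) \<noteq> 0" using False by (auto simp: null_sets_def)
    then have "\<infinity> = \<infinity> * emeasure lborel ({0..l} - T)" by (simp add: ennreal_top_mult)
    also have "\<dots> = (\<integral>\<^sup>+s. \<infinity> * indicator ({0..l} - T) s \<partial>lborel)"
      using T by (subst nn_integral_cmult_indicator) auto
    also have "\<dots> \<le> (\<integral>\<^sup>+s\<in>{0..l}. \<rho> (h s) \<partial>lborel)"
    proof (rule nn_integral_mono)
      fix s
      show "\<infinity> * indicator ({0..l} - T) s \<le> \<rho> (h s) * indicator {0..l} s"
        using \<rho>N[of "h s"] Hh[of s] by (auto simp: T_def split: split_indicator)
    qed
    finally show ?thesis by (simp add: top_unique)
  next
    case True
    have "1 \<le> (\<integral>\<^sup>+s\<in>{r1<..<r2}. \<eta> s \<partial>lborel)" by (rule \<eta>)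
    also have "\<dots> \<le> (\<integral>\<^sup>+s\<in>T. \<eta> (dist (f (h s)) y0) * indicator {r1<..<r2} (dist (f (h s)) y0) *
        ennreal (\<Lambda> (H s)) \<partial>lborel)"
    proof (rule nn_integral_le_along_abs_cont[OF ac \<open>0 < l\<close>])
      show "(\<lambda>s. \<Lambda> (H s)) \<in> borel_measurable borel" using H \<Lambda>(1) by (rule measurable_compose)
      fix s e :: real
      assume s: "s \<in> T" "r1 < dist (f (h s)) y0" and "e > 0"
      have "f (h s) \<noteq> y0" using s r by auto
      from dist_image_growth[OF good(1)[OF Ts(2,3)[OF s(1)]] this \<open>e > 0\<close>]
      obtain d where d: "d > 0" "\<And>z. dist z (h s) < d \<Longrightarrow>
          \<bar>dist (f z) y0 - dist (f (h s)) y0\<bar> \<le> (radial_stretch f y0 (h s) + e) * dist z (h s)"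
        by blast
      have \<Lambda>s: "\<Lambda> (H s) = radial_stretch f y0 (h s)" using good(2) Ts[OF s(1)] Hh by simp
      show "\<exists>d>0. \<forall>t\<in>{0..l}. \<bar>t - s\<bar> < d \<longrightarrow>
          \<bar>dist (f (h t)) y0 - dist (f (h s)) y0\<bar> \<le> (\<Lambda> (H s) + e) * \<bar>t - s\<bar>"
      proof (intro exI[of _ d] conjI ballI impI d(1))
        fix t assume t: "t \<in> {0..l}" "\<bar>t - s\<bar> < d"
        \<comment> \<open>The Lipschitz bound turns growth in space into growth in the arc length
          parameter.\<close>
        have le: "dist (h t) (h s) \<le> \<bar>t - s\<bar>" using lip t Ts[OF s(1)] by blast
        then have "\<bar>dist (f (h t)) y0 - dist (f (h s)) y0\<bar> \<le> (\<Lambda> (H s) + e) * dist (h t) (h s)"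
          using d(2)[of "h t"] t \<Lambda>s by simp
        also have "\<dots> \<le> (\<Lambda> (H s) + e) * \<bar>t - s\<bar>"
          using le \<Lambda>(2)[of "H s"] \<open>e > 0\<close> by (intro mult_left_mono) auto
        finally show "\<bar>dist (f (h t)) y0 - dist (f (h s)) y0\<bar> \<le> (\<Lambda> (H s) + e) * \<bar>t - s\<bar>" .
      qed
    qed (use e0 el T \<Lambda>(2) \<eta>(1) True in \<open>auto simp: T_def\<close>)
    also have "\<dots> \<le> (\<integral>\<^sup>+s\<in>{0..l}. \<rho> (h s) \<partial>lborel)"
    proof (rule nn_integral_mono)
      fix s
      show "\<eta> (dist (f (h s)) y0) * indicator {r1<..<r2} (dist (f (h s)) y0) *
        ennreal (\<Lambda> (H s)) * indicator T s \<le> \<rho> (h s) * indicator {0..l} s"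
      proof (cases "s \<in> T")
        case True
        then show ?thesis using Ts[OF True] \<rho>[of "h s"] Hh[of s] by simp
      qed simp
    qed
    finally show ?thesis .
  qed
  also have "\<dots> \<le> line_integral \<rho> (I, g)"
    unfolding line_integral.simps h_def l_def
    by (rule SUP_upper2[of "(a, b)"]) (use ab in auto)
  finally show ?thesis .
qed

text \<open>Replacing \<open>\<eta>\<close> by a Borel function below it spares the fact that null sets of radii have null
  preimages under the distance to \<open>y0\<close>.\<close>

lemma borel_minorant:
  fixes \<eta> :: "'a::euclidean_space \<Rightarrow> ennreal"
  assumes \<eta>: "\<eta> \<in> borel_measurable (lebesgue_on S)" and S: "S \<in> sets lebesgue"
  obtains \<eta>' where "\<eta>' \<in> borel_measurable borel" "\<And>x. x \<in> S \<Longrightarrow> \<eta>' x \<le> \<eta> x"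
    "(\<integral>\<^sup>+x\<in>S. \<eta>' x \<partial>lborel) = (\<integral>\<^sup>+x\<in>S. \<eta> x \<partial>lebesgue)"
proof -
  have "(\<lambda>x. \<eta> x * indicator S x) \<in> borel_measurable lebesgue"
    using \<eta> S by (subst (asm) borel_measurable_restrict_space_iff_ennreal) auto
  from completion_ex_borel_measurable[OF this]
  obtain g where g: "g \<in> borel_measurable lborel" "AE x in lborel. \<eta> x * indicator S x = g x" by blast
  from AE_E[OF g(2)] obtain N where N: "{x \<in> space lborel. \<eta> x * indicator S x \<noteq> g x} \<subseteq> N"
    "emeasure lborel N = 0" "N \<in> sets lborel" by blast
  \<comment> \<open>The value 0 on \<open>N\<close> makes this a minorant at every point of
    \<open>S\<close>, not merely almost everywhere.\<close>
  define \<eta>' where "\<eta>' = (\<lambda>x. g x * indicator (- N) x)"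
  have eq: "\<eta>' x = \<eta> x" if "x \<in> S" "x \<notin> N" for x
  proof -
    have "x \<notin> {x \<in> space lborel. \<eta> x * indicator S x \<noteq> g x}" using N(1) that by blast
    then have "\<eta> x * indicator S x = g x" by simp
    then show ?thesis using that by (simp add: \<eta>'_def)
  qed
  show thesis
  proof (rule that)
    show "\<eta>' \<in> borel_measurable borel" using g(1) N(3) unfolding \<eta>'_def by measurable
    show "\<eta>' x \<le> \<eta> x" if "x \<in> S" for x
      using eq[OF that] by (cases "x \<in> N") (auto simp: \<eta>'_def)
    have "AE x in lborel. x \<notin> N" using N by (intro AE_not_in) auto
    then show "(\<integral>\<^sup>+x\<in>S. \<eta>' x \<partial>lborel) = (\<integral>\<^sup>+x\<in>S. \<eta> x \<partial>lebesgue)"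
      unfolding nn_integral_completion
      by (intro nn_integral_cong_AE) (auto elim!: eventually_mono simp: eq split: split_indicator)
  qed
qed

section \<open>The inverse Poletsky inequality\<close>

theorem mainTheorem1:
  fixes D :: "(real^'n::{finite,wellorder}) set"
    and f :: "real^'n::_ \<Rightarrow> real^'n::_"
    and y0 :: "real^'n::_"
    and p :: real
  assumes "CARD('n) \<ge> 2"
    and "p > 1"
    and "open D" "connected D" "D \<noteq> {}"
    and "AE x in lebesgue. x \<in> D \<longrightarrow> f differentiable (at x)"
    and "Luzin_N D f"
    and "Luzin_N_inv D f"
    and "ACP p D f"
    and "y0 \<in> closure (f ` D)"
  shows "inverse_Poletsky p D f y0 (cotangent_dilatation p D f y0)"
  unfolding inverse_Poletsky_def
proof (intro allI impI, elim conjE)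
  fix r1 r2 :: real and \<eta> :: "real \<Rightarrow> ennreal"
  assume r: "0 < r1" "r1 < r2"
    and \<eta>: "\<eta> \<in> borel_measurable (lebesgue_on {r1<..<r2})" "1 \<le> (\<integral>\<^sup>+r\<in>{r1<..<r2}. \<eta> r \<partial>lebesgue)"
  let ?f' = "\<lambda>x. frechet_derivative f (at x)"
  have der: "(f has_derivative ?f' x) (at x)" if "f differentiable (at x)" for x
    using that frechet_derivative_works by blast
  define Z where "Z = {x \<in> D. f differentiable (at x) \<and> jacobian f x = 0}"
  have Z: "Z \<in> null_sets lebesgue"
  proof -
    \<comment> \<open>On \<open>Z\<close> the derivative is rank deficient, so Sard applies;
      \<open>Z\<close> is contained in the preimage of its own image.\<close>
    have "negligible (f ` Z)"
    proof (rule baby_Sard)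
      show "(f has_derivative ?f' x) (at x within Z)" if "x \<in> Z" for x
        using der that by (auto simp: Z_def intro: has_derivative_at_withinI)
      show "rank (matrix (?f' x)) < CARD('n)" if "x \<in> Z" for x
        using that by (simp add: Z_def jacobian_def det_eq_0_rank)
    qed simp
    then have "{x \<in> D. f x \<in> f ` Z} \<in> null_sets lebesgue"
      using \<open>Luzin_N_inv D f\<close> by (simp add: Luzin_N_inv_def negligible_iff_null_sets)
    then show ?thesis
      unfolding negligible_iff_null_sets[symmetric] by (rule negligible_subset) (auto simp: Z_def)
  qed
  define W where "W = {x \<in> D. \<not> f differentiable (at x)}"
  have W: "W \<in> null_sets lebesgue"
  proof -
    from AE_E[OF assms(6)] obtain N where "{x \<in> space lebesgue. \<not> (x \<in> D \<longrightarrow> f differentiable (at x))} \<subseteq> N"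
      "emeasure lebesgue N = 0" "N \<in> sets lebesgue" by blast
    then have "N \<in> null_sets lebesgue" "W \<subseteq> N" by (auto simp: W_def null_sets_def)
    then show ?thesis unfolding negligible_iff_null_sets[symmetric] using negligible_subset by blast
  qed
  define G where "G = D - (Z \<union> W)"
  have G: "G \<in> sets lebesgue" unfolding G_def using Z W \<open>open D\<close> by (auto simp: null_sets_def)
  have Gd: "f differentiable (at x)" "jacobian f x \<noteq> 0" if "x \<in> G" for x
    using that by (auto simp: G_def Z_def W_def)
  have derG: "(f has_derivative ?f' x) (at x within S)" if "x \<in> G" for x S
    using der[OF Gd(1)[OF that]] by (rule has_derivative_at_withinI)
  have contG: "continuous_on G f"
    using derG has_derivative_continuous by (force simp: continuous_on_eq_continuous_within)
  have fG: "f \<in> borel_measurable (lebesgue_on G)"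
    by (rule continuous_imp_measurable_on_sets_lebesgue[OF contG G])
  have \<Lambda>G: "radial_stretch f y0 \<in> borel_measurable (lebesgue_on G)"
  proof -
    have mat: "(\<lambda>x. matrix (?f' x) $ i $ j) \<in> borel_measurable (lebesgue_on G)" for i j
      using borel_measurable_partial_derivatives[OF G derG] .
    have sg: "(\<lambda>x. sgn (f x - y0) $ i) \<in> borel_measurable (lebesgue_on G)" for i
      unfolding sgn_div_norm cart_eq_inner_axis using fG by measurable
    have "(\<lambda>x. norm (sgn (f x - y0) v* matrix (?f' x))) \<in> borel_measurable (lebesgue_on G)"
      unfolding norm_vec_def L2_set_def vector_matrix_mult_def vec_lambda_beta
      using mat sg by measurable
    moreover have "norm (sgn (f x - y0) v* matrix (?f' x)) = radial_stretch f y0 x"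
      if "x \<in> space (lebesgue_on G)" for x
      using radial_stretch_eq_norm[OF Gd(1)] that by simp
    ultimately show ?thesis by (rule measurable_cong[THEN iffD1, rotated])
  qed
  have m: "(\<lambda>x. if x \<in> G then radial_stretch f y0 x else 0) \<in> borel_measurable lebesgue"
    "(\<lambda>x. if x \<in> G then dist (f x) y0 else 0) \<in> borel_measurable lebesgue"
    using \<Lambda>G fG by (auto intro!: borel_measurable_if_I[OF _ G])
  \<comment> \<open>Borel representatives of the radial stretch and of \<bar>f - y0\<bar>. For the
    latter, composing a Borel \<open>\<eta>'\<close> with a merely Lebesgue measurable map would not
    give a Borel function.\<close>
  obtain \<Lambda>' where \<Lambda>': "\<Lambda>' \<in> borel_measurable lborel"
      "AE x in lborel. (if x \<in> G then radial_stretch f y0 x else 0) = \<Lambda>' x"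
    using completion_ex_borel_measurable_real[OF m(1)] by blast
  obtain \<Phi> where \<Phi>': "\<Phi> \<in> borel_measurable lborel"
      "AE x in lborel. (if x \<in> G then dist (f x) y0 else 0) = \<Phi> x"
    using completion_ex_borel_measurable_real[OF m(2)] by blast
  \<comment> \<open>The truncation secures nonnegativity at the points where
    \<open>\<Lambda>'\<close> is unrelated to the radial stretch.\<close>
  define \<Lambda> where "\<Lambda> = (\<lambda>x. max 0 (\<Lambda>' x))"
  have \<Lambda>: "\<Lambda> \<in> borel_measurable borel" "\<And>x. 0 \<le> \<Lambda> x" using \<Lambda>'(1) by (auto simp: \<Lambda>_def)
  have \<Phi>: "\<Phi> \<in> borel_measurable borel" using \<Phi>'(1) by simp
  have "AE x in lborel. x \<notin> Z \<union> W"
    using AE_not_in[OF null_sets.Un[OF Z W]] by (simp add: AE_completion_iff)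
  with \<Lambda>'(2) \<Phi>'(2) have "AE x in lborel. x \<notin> Z \<union> W \<and> (if x \<in> G then radial_stretch f y0 x else 0) = \<Lambda>' x \<and>
      (if x \<in> G then dist (f x) y0 else 0) = \<Phi> x"
    by eventually_elim auto
  \<comment> \<open>One Borel null set collects \<open>Z\<close>, \<open>W\<close> and all points
    where a representative differs from its original.\<close>
  from AE_E[OF this] obtain N where N: "emeasure lborel N = 0" "N \<in> sets lborel"
    and off: "\<And>x. x \<notin> N \<Longrightarrow> x \<notin> Z \<union> W \<and> (if x \<in> G then radial_stretch f y0 x else 0) = \<Lambda>' x \<and>
      (if x \<in> G then dist (f x) y0 else 0) = \<Phi> x"
    by (smt (verit, best) mem_Collect_eq space_lborel subset_iff UNIV_I space_borel)
  have DN: "x \<in> G" if "x \<in> D" "x \<notin> N" for x using off[OF that(2)] that by (simp add: G_def)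
  have \<Lambda>eq: "\<Lambda> x = radial_stretch f y0 x" if "x \<in> D" "x \<notin> N" for x
  proof -
    have "\<Lambda>' x = radial_stretch f y0 x" using off[OF that(2)] DN[OF that] by simp
    then show ?thesis using radial_stretch_eq_norm[OF Gd(1)[OF DN[OF that]]] by (simp add: \<Lambda>_def)
  qed
  have \<Phi>eq: "\<Phi> x = dist (f x) y0" if "x \<in> D" "x \<notin> N" for x
    using off[OF that(2)] DN[OF that] by simp
  obtain \<eta>' where \<eta>': "\<eta>' \<in> borel_measurable borel" "\<And>s. s \<in> {r1<..<r2} \<Longrightarrow> \<eta>' s \<le> \<eta> s"
    "(\<integral>\<^sup>+s\<in>{r1<..<r2}. \<eta>' s \<partial>lborel) = (\<integral>\<^sup>+s\<in>{r1<..<r2}. \<eta> s \<partial>lebesgue)"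
    by (rule borel_minorant[OF \<eta>(1)]) auto
  define w where "w = (\<lambda>s. \<eta>' s * indicator {r1<..<r2} s)"
  have w: "w \<in> borel_measurable borel" using \<eta>'(1) by (simp add: w_def)
  define \<rho> where "\<rho> = (\<lambda>x. if x \<in> N then \<infinity> else if x \<in> D then w (\<Phi> x) * ennreal (\<Lambda> x) else 0)"
  have [measurable]: "N \<in> sets borel" "D \<in> sets borel" using N(2) \<open>open D\<close> by auto
  note [measurable] = \<Lambda>(1) measurable_compose[OF \<Phi> w]
  have \<rho>: "\<rho> \<in> borel_measurable borel"
    unfolding \<rho>_def by measurable
  have "modulus p (preimage_family D f y0 r1 r2) \<le> (\<integral>\<^sup>+x. ennpowr (\<rho> x) p \<partial>lborel)"
  proof (rule modulus_le_nn_integral[OF \<rho>])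
    show "preimage_family D f y0 r1 r2 \<subseteq> curves_in D" by (auto simp: preimage_family_def)
    show "almost_all_curves p D (locally_abs_cont_on f)" using \<open>ACP p D f\<close> by (simp add: ACP_def)
    fix c assume c: "c \<in> preimage_family D f y0 r1 r2" "locally_rectifiable c" "locally_abs_cont_on f c"
    obtain I g where Ig: "c = (I, g)" by (cases c)
    show "1 \<le> line_integral \<rho> c"
      unfolding Ig
    proof (rule line_integral_ge_1[OF c[unfolded Ig] r _ \<Lambda>])
      show "1 \<le> (\<integral>\<^sup>+s\<in>{r1<..<r2}. \<eta>' s \<partial>lborel)" using \<eta>(2) \<eta>'(3) by simp
      fix x assume x: "x \<in> D" "x \<notin> N"
      show "f differentiable (at x)" using Gd DN[OF x] by blast
      show "\<rho> x = \<eta>' (dist (f x) y0) * indicator {r1<..<r2} (dist (f x) y0) * ennreal (\<Lambda> x)"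
        using x \<Phi>eq[OF x] by (simp add: \<rho>_def w_def)
    qed (use N(2) \<eta>'(1) \<Lambda>eq in \<open>auto simp: \<rho>_def\<close>)
  qed
  also have "(\<integral>\<^sup>+x. ennpowr (\<rho> x) p \<partial>lborel) =
      (\<integral>\<^sup>+x\<in>D - N. ennpowr (w (\<Phi> x)) p * ennreal (\<Lambda> x powr p) \<partial>lborel)"
  proof (rule nn_integral_cong_AE)
    have "AE x in lborel. x \<notin> N" using N by (intro AE_not_in) auto
    then show "AE x in lborel. ennpowr (\<rho> x) p =
        ennpowr (w (\<Phi> x)) p * ennreal (\<Lambda> x powr p) * indicator (D - N) x"
      by eventually_elim (auto simp: \<rho>_def ennpowr_mult_ennreal \<Lambda>(2) split: split_indicator)
  qed
  also have "\<dots> = (\<integral>\<^sup>+x\<in>D - N. ennpowr (w (\<Phi> x)) p * ennreal (\<Lambda> x powr p) \<partial>lebesgue)"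
    by (simp add: nn_integral_completion)
  also have "\<dots> \<le> (\<integral>\<^sup>+y. (\<Sum>\<^sub>\<infinity>x\<in>{x \<in> D - N. f x = y}. ennpowr (w (\<Phi> x)) p * ennreal (\<Lambda> x powr p)
      / ennreal \<bar>det (matrix (?f' x))\<bar>) \<partial>lebesgue)"
  proof (rule nn_integral_le_nn_integral_infsum_preimage)
    show "D - N \<in> sets lebesgue" using N(2) \<open>open D\<close> by auto
    have "(\<lambda>x. ennpowr (w (\<Phi> x)) p * ennreal (\<Lambda> x powr p)) \<in> borel_measurable borel"
      by measurable
    then show "(\<lambda>x. ennpowr (w (\<Phi> x)) p * ennreal (\<Lambda> x powr p)) \<in> borel_measurable lebesgue"
      by (simp add: measurable_completion)
  qed (use DN derG Gd in \<open>auto simp: jacobian_def\<close>)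
  also have "\<dots> \<le> (\<integral>\<^sup>+y\<in>annulus y0 r1 r2 \<inter> f ` D.
      cotangent_dilatation p D f y0 y * ennpowr (\<eta> (dist y y0)) p \<partial>lebesgue)"
  \<comment> \<open>Pointwise in \<open>y\<close>, and for finite parts \<open>S\<close> of the
    fibre: there \<open>\<Phi> x\<close> equals \<bar>y - y0\<bar>, so the factor with
    \<open>w\<close> is constant and leaves the sum.\<close>
  proof (rule nn_integral_mono, rule infsum_le_ennreal)
    fix y S assume S: "finite S" "S \<subseteq> {x \<in> D - N. f x = y}"
    let ?d = "dist y y0" and ?k = "\<lambda>x. ennreal (radial_stretch f y0 x powr p) / ennreal \<bar>jacobian f x\<bar>"
    have "(\<Sum>x\<in>S. ennpowr (w (\<Phi> x)) p * ennreal (\<Lambda> x powr p) / ennreal \<bar>det (matrix (?f' x))\<bar>)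
        = (\<Sum>x\<in>S. ennpowr (w ?d) p * ?k x)"
      using S(2) \<Lambda>eq \<Phi>eq by (intro sum.cong) (auto simp: jacobian_def ennreal_times_divide subset_iff)
    also have "\<dots> = ennpowr (w ?d) p * (\<Sum>x\<in>S. ?k x)" by (simp add: sum_distrib_left)
    also have "\<dots> \<le> cotangent_dilatation p D f y0 y * ennpowr (\<eta> ?d) p * indicator (annulus y0 r1 r2 \<inter> f ` D) y"
    proof (cases "y \<in> annulus y0 r1 r2 \<and> S \<noteq> {}")
      case True
      then have d: "?d \<in> {r1<..<r2}" and "y \<in> f ` D" using S(2) by (auto simp: annulus_def)
      have "ennpowr (w ?d) p \<le> ennpowr (\<eta> ?d) p"
        using d \<eta>'(2)[OF d] \<open>p > 1\<close> by (intro ennpowr_mono) (auto simp: w_def)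
      moreover have "(\<Sum>x\<in>S. ?k x) \<le> cotangent_dilatation p D f y0 y"
        unfolding cotangent_dilatation_def radial_stretch_def
        using S by (intro finite_sum_le_infsum_ennreal) auto
      ultimately have "ennpowr (w ?d) p * (\<Sum>x\<in>S. ?k x)
          \<le> ennpowr (\<eta> ?d) p * cotangent_dilatation p D f y0 y" by (intro mult_mono) auto
      then show ?thesis using True \<open>y \<in> f ` D\<close> by (simp add: mult.commute)
    next
      case False
      \<comment> \<open>Outside the annulus the indicator in \<open>w\<close> kills the left-hand
        side; in the annulus only the empty sum is left.\<close>
      then have "S = {} \<or> w ?d = 0" by (auto simp: w_def annulus_def split: split_indicator)
      then show ?thesis by auto
    qed
    finally show "(\<Sum>x\<in>S. ennpowr (w (\<Phi> x)) p * ennreal (\<Lambda> x powr p) / ennreal \<bar>det (matrix (?f' x))\<bar>)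
        \<le> cotangent_dilatation p D f y0 y * ennpowr (\<eta> ?d) p * indicator (annulus y0 r1 r2 \<inter> f ` D) y" .
  qed
  finally show "modulus p (preimage_family D f y0 r1 r2)
      \<le> (\<integral>\<^sup>+y\<in>annulus y0 r1 r2 \<inter> f ` D.
          cotangent_dilatation p D f y0 y * ennpowr (\<eta> (dist y y0)) p \<partial>lebesgue)" .
qed

end
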